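(* Consider the regularized online allocation problem and the Dual Mirror Descent Algorithm $A$ described in the context, with step-size $\eta>0$ and initial solution $\mu_0\in\mathcal D$. Suppose the assumptions on the requests, on the regularizer and on the reference function given in the context are satisfied. Then for any $T\ge 1$, $$\mathrm{Regret}(A)\le C_1+C_2\,\eta\, T+\frac{C_3}{\eta},$$ where $\underline\rho=\min_{j\in[m]}\rho_j$, $C_1=\bar b\,(\bar f+\bar r+L(\bar b+\bar a))/\underline\rho$, $C_2=(\bar b+\bar a)^2/(2\sigma)$, and $C_3=\sup\{V_h(\mu,\mu_0):\mu\in\mathcal D,\ \|\mu\|_1\le L+C_1/\bar b\}$.
   Context: Problem. There are $T$ time periods, $m$ resources, and a vector $\rho\in\mathbb R^m$ with positive entries; $T\rho$ is the total amount of resources. A request is a triple $\gamma=(f,b,\mathcal X)$ with decision set $\mathcal X\subset\mathbb R^d_+$ (possibly non-convex), reward function $f:\mathcal X\to\mathbb R_+$ (possibly non-concave) and consumption function $b:\mathcal X\to\mathbb R^m_+$ (possibly non-linear), with $0\in\mathcal X$ and $b(0)=0$. $\mathcal S$ is the set of all possible requests. Vector inequalities are coordinate-wise. $r:\{a\in\mathbb R^m:a\le\rho\}\to\mathbb R$ is the regularizer. For a sequence $\vec\gamma=(\gamma_1,\dots,\gamma_T)\in\mathcal S^T$, $\gamma_t=(f_t,b_t,\mathcal X_t)$, $$\mathrm{OPT}(\vec\gamma)=\max_{x_t\in\mathcal X_t}\ \sum_{t=1}^T f_t(x_t)+T\,r\Big(\tfrac1T\sum_{t=1}^T b_t(x_t)\Big)\quad\text{s.t.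 }\sum_{t=1}^T b_t(x_t)\le T\rho .$$ If an online algorithm $A$ takes actions $x_t$, its regularized reward is $R(A|\vec\gamma)=\sum_{t=1}^T f_t(x_t)+T\,r(\frac1T\sum_{t=1}^T b_t(x_t))$. With $\Delta(\mathcal S)$ the set of probability distributions on $\mathcal S$, $$\mathrm{Regret}(A)=\sup_{\mathcal P\in\Delta(\mathcal S)}\mathbb E_{\gamma_t\sim\mathcal P}\big[\mathrm{OPT}(\vec\gamma)-R(A|\vec\gamma)\big],$$ where $\gamma_1,\dots,\gamma_T$ are i.i.d. from $\mathcal P$. Dual objects. $r^*(-\mu)=\sup_{a\le\rho}\{r(a)+\mu^\top a\}$ and $\mathcal D=\{\mu\in\mathbb R^m: r^*(-\mu)<+\infty\}$. Assumptions on the requests. There are $\bar f,\bar b\in\mathbb R_+$ such that for all $(f,b,\mathcal X)\in\mathcal S$ and $x\in\mathcal X$: $0\le f(x)\le\bar f$, $b(x)\ge0$, $\|b(x)\|_\infty\le\bar b$. Assumptions on the regularizer. (1) $|r(a_1)-r(a_2)|\le L\|a_1-a_2\|_\infty$ for all $a_1,a_2\le\rho$; (2) there is $\bar a$ such that for any $\mu\in\mathcal D$ there exists $a\in\arg\max_{a\le\rho}\{r(a)+\mu^\top a\}$ with $\|a\|_\infty\le\bar a$; (3) there is $\bar r$ with $0\le r(a)\le\bar r$ for all $0\le a\le\rho$; (4) $r$ is concave. Assumptions on the reference function $h:\mathbb R^m\to\mathbb R$. $h$ is either differentiable or essentially smooth in $\mathcal D$, and $h$ is $\sigma$-strongly convex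 ($\sigma>0$) in the $\ell_1$-norm on $\mathcal D$: $h(\mu_1)\ge h(\mu_2)+\langle\nabla h(\mu_2),\mu_1-\mu_2\rangle+\frac\sigma2\|\mu_1-\mu_2\|_1^2$ for all $\mu_1,\mu_2\in\mathcal D$. The Bregman divergence is $V_h(x,y)=h(x)-h(y)-\nabla h(y)^\top(x-y)$. Dual Mirror Descent Algorithm. Inputs: $\mu_0\in\mathcal D$, $T$, $h$, step-size $\eta$. Start with current dual variable $\mu_1:=\mu_0$ and remaining resources $B_1=T\rho$. For $t=1,\dots,T$: receive $(f_t,b_t,\mathcal X_t)$; compute $\tilde x_t\in\arg\max_{x\in\mathcal X_t}\{f_t(x)-\mu_t^\top b_t(x)\}$ (maximizers are assumed to exist); set $x_t=\tilde x_t$ if $b_t(\tilde x_t)\le B_t$ and $x_t=0$ otherwise; set $B_{t+1}=B_t-b_t(x_t)$; choose $a_t\in\arg\max_{a\le\rho}\{r(a)+\mu_t^\top a\}$ with $\|a_t\|_\infty\le\bar a$; set $\tilde g_t=-b_t(x_t)+a_t$; update $\mu_{t+1}=\arg\min_{\mu\in\mathcal D}\{\langle\tilde g_t,\mu\rangle+\frac1\eta V_h(\mu,\mu_t)\}$. In the expression $C_1/\bar b$ the factor $\bar b$ cancels: $C_1/\bar b=(\bar f+\bar r+L(\bar b+\bar a))/\underline\rho$. *)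

theory Defs
  imports "HOL-Probability.Probability"
begin

type_synonym ('d, 'm) request =
  "((real, 'd) vec \<Rightarrow> real) \<times> ((real, 'd) vec \<Rightarrow> (real, 'm) vec) \<times> (real, 'd) vec set"

abbreviation reward :: "('d::finite, 'm::finite) request \<Rightarrow> real ^ 'd \<Rightarrow> real" where
  "reward \<gamma> \<equiv> fst \<gamma>"

abbreviation consumption :: "('d::finite, 'm::finite) request \<Rightarrow> real ^ 'd \<Rightarrow> real ^ 'm" where
  "consumption \<gamma> \<equiv> fst (snd \<gamma>)"

abbreviation decisions :: "('d::finite, 'm::finite) request \<Rightarrow> (real ^ 'd) set" where
  "decisions \<gamma> \<equiv> snd (snd \<gamma>)"

text \<open>
  The order on vectors is the coordinate-wise one, and \<open>infnorm\<close> is the maximum norm. Values of the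
  reward and consumption functions outside the decision set are never used, and neither are values of
  the regularizer outside \<open>{..\<rho>}\<close>.
\<close>

definition valid_request :: "real \<Rightarrow> real \<Rightarrow> ('d::finite, 'm::finite) request \<Rightarrow> bool" where
  "valid_request fbar bbar \<gamma> \<longleftrightarrow>
     0 \<in> decisions \<gamma> \<and> consumption \<gamma> 0 = 0 \<and>
     (\<forall>x\<in>decisions \<gamma>. 0 \<le> x \<and> 0 \<le> reward \<gamma> x \<and> reward \<gamma> x \<le> fbar \<and>
        0 \<le> consumption \<gamma> x \<and> infnorm (consumption \<gamma> x) \<le> bbar)"

definition l1norm :: "real ^ 'm::finite \<Rightarrow> real" where
  "l1norm v = (\<Sum>j\<in>UNIV. \<bar>v $ j\<bar>)"

subsection \<open>Rewards, offline optimum and regret\<close>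

text \<open>A sequence of requests is a function on the periods \<open>{1..T}\<close>.\<close>

definition total_reward ::
  "nat \<Rightarrow> (real ^ 'm::finite \<Rightarrow> real) \<Rightarrow> (nat \<Rightarrow> ('d::finite, 'm) request) \<Rightarrow> (nat \<Rightarrow> real ^ 'd) \<Rightarrow> real"
  where "total_reward T r \<gamma> x =
     (\<Sum>t\<in>{1..T}. reward (\<gamma> t) (x t)) +
     real T * r ((1 / real T) *\<^sub>R (\<Sum>t\<in>{1..T}. consumption (\<gamma> t) (x t)))"

definition feasible ::
  "nat \<Rightarrow> real ^ 'm::finite \<Rightarrow> (nat \<Rightarrow> ('d::finite, 'm) request) \<Rightarrow> (nat \<Rightarrow> real ^ 'd) set"
  where "feasible T \<rho> \<gamma> =
     {x. (\<forall>t\<in>{1..T}. x t \<in> decisions (\<gamma> t)) \<and>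
         (\<Sum>t\<in>{1..T}. consumption (\<gamma> t) (x t)) \<le> real T *\<^sub>R \<rho>}"

text \<open>
  The maximum is written as a supremum, which agrees with it whenever it is attained. For valid
  requests and a regularizer bounded on \<open>{0..\<rho>}\<close> the set below is nonempty and bounded above.
\<close>

definition OPT ::
  "nat \<Rightarrow> real ^ 'm::finite \<Rightarrow> (real ^ 'm \<Rightarrow> real) \<Rightarrow> (nat \<Rightarrow> ('d::finite, 'm) request) \<Rightarrow> real"
  where "OPT T \<rho> r \<gamma> = (SUP x\<in>feasible T \<rho> \<gamma>. total_reward T r \<gamma> x)"

text \<open>
  An online rule picks a value in each period from the requests seen so far: period \<open>t\<close> only has
  access to the requests of the periods \<open>{1..t}\<close>.
\<close>

type_synonym ('d, 'm, 'v) online_rule = "nat \<Rightarrow> (nat \<Rightarrow> ('d, 'm) request) \<Rightarrow> 'v"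

definition play ::
  "('d::finite, 'm::finite, 'v) online_rule \<Rightarrow> (nat \<Rightarrow> ('d, 'm) request) \<Rightarrow> nat \<Rightarrow> 'v" where
  "play A \<gamma> t = A t (restrict \<gamma> {1..t})"

text \<open>
  The set of all possible requests is \<open>space M\<close>; the distributions on it are the probability
  measures on the \<open>\<sigma>\<close>-algebra of \<open>M\<close> (the measure carried by \<open>M\<close> itself plays no role).
\<close>

definition regret ::
  "('d::finite, 'm::finite) request measure \<Rightarrow> nat \<Rightarrow> real ^ 'm \<Rightarrow> (real ^ 'm \<Rightarrow> real) \<Rightarrow>
   ('d, 'm, real ^ 'd) online_rule \<Rightarrow> ereal"
  where "regret M T \<rho> r A =
     (SUP P\<in>{P. prob_space P \<and> sets P = sets M}.
        ereal (\<integral>\<gamma>. OPT T \<rho> r \<gamma> - total_reward T r \<gamma> (play A \<gamma>) \<partial>(\<Pi>\<^sub>M t\<in>{1..T}. P)))"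

subsection \<open>Dual objects\<close>

definition reg_conj :: "real ^ 'm::finite \<Rightarrow> (real ^ 'm \<Rightarrow> real) \<Rightarrow> real ^ 'm \<Rightarrow> ereal" where
  "reg_conj \<rho> r c = (SUP a\<in>{..\<rho>}. ereal (r a - c \<bullet> a))"

definition dual_dom :: "real ^ 'm::finite \<Rightarrow> (real ^ 'm \<Rightarrow> real) \<Rightarrow> (real ^ 'm) set" where
  "dual_dom \<rho> r = {\<mu>. reg_conj \<rho> r (- \<mu>) < \<infinity>}"

definition reg_argmax ::
  "real ^ 'm::finite \<Rightarrow> (real ^ 'm \<Rightarrow> real) \<Rightarrow> real ^ 'm \<Rightarrow> (real ^ 'm) set" where
  "reg_argmax \<rho> r \<mu> = {a. is_arg_max (\<lambda>a. r a + \<mu> \<bullet> a) (\<lambda>a. a \<le> \<rho>) a}"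

subsection \<open>Reference function\<close>

text \<open>
  Differentiability is taken relative to the dual domain \<open>D\<close>. If \<open>\<mu> \<in> D\<close> and \<open>\<mu> \<le> \<nu>\<close> then
  \<open>\<nu> \<in> D\<close>, so derivatives within \<open>D\<close> are unique, and the gradient below is the usual one wherever
  \<open>h\<close> is differentiable in a full neighbourhood.
\<close>

definition grad :: "(real ^ 'm::finite) set \<Rightarrow> (real ^ 'm \<Rightarrow> real) \<Rightarrow> real ^ 'm \<Rightarrow> real ^ 'm" where
  "grad D h x = (\<chi> j. frechet_derivative h (at x within D) (axis j 1))"

definition bregman ::
  "(real ^ 'm::finite) set \<Rightarrow> (real ^ 'm \<Rightarrow> real) \<Rightarrow> real ^ 'm \<Rightarrow> real ^ 'm \<Rightarrow> real" where
  "bregman D h x y = h x - h y - grad D h y \<bullet> (x - y)"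

text \<open>
  Essential smoothness in the sense of Rockafellar; the convexity that usually accompanies it comes
  from strong convexity.
\<close>

definition essentially_smooth_in ::
  "(real ^ 'm::finite) set \<Rightarrow> (real ^ 'm \<Rightarrow> real) \<Rightarrow> bool" where
  "essentially_smooth_in D h \<longleftrightarrow>
     interior D \<noteq> {} \<and> h differentiable_on interior D \<and>
     (\<forall>s l. (\<forall>n::nat. s n \<in> interior D) \<and> s \<longlonglongrightarrow> l \<and> l \<in> frontier D \<longrightarrow>
        filterlim (\<lambda>n. norm (grad D h (s n))) at_top sequentially)"

text \<open>
  The gradient inequality is imposed at the points where the gradient exists. This is all of \<open>D\<close> if
  \<open>h\<close> is differentiable in \<open>D\<close>, but an essentially smooth function such as the negative entropy has
  no gradient on the boundary.
\<close>

definition strongly_convex_in ::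
  "real \<Rightarrow> (real ^ 'm::finite) set \<Rightarrow> (real ^ 'm \<Rightarrow> real) \<Rightarrow> bool" where
  "strongly_convex_in \<sigma> D h \<longleftrightarrow>
     (\<forall>\<mu>1\<in>D. \<forall>\<mu>2\<in>D. h differentiable (at \<mu>2 within D) \<longrightarrow>
        h \<mu>1 \<ge> h \<mu>2 + grad D h \<mu>2 \<bullet> (\<mu>1 - \<mu>2) + \<sigma> / 2 * (l1norm (\<mu>1 - \<mu>2))\<^sup>2)"

subsection \<open>Dual mirror descent\<close>

text \<open>
  The actions \<open>x\<close> and the vectors \<open>a\<close> arise from a run of the algorithm on the sequence \<open>\<gamma>\<close>. The
  relational form leaves all ties among maximizers open.
\<close>

definition dmd_run ::
  "nat \<Rightarrow> real ^ 'm::finite \<Rightarrow> (real ^ 'm \<Rightarrow> real) \<Rightarrow> real \<Rightarrow> (real ^ 'm \<Rightarrow> real) \<Rightarrow> real \<Rightarrow> real ^ 'm \<Rightarrow>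
   (nat \<Rightarrow> ('d::finite, 'm) request) \<Rightarrow> (nat \<Rightarrow> real ^ 'd) \<Rightarrow> (nat \<Rightarrow> real ^ 'm) \<Rightarrow> bool"
  where "dmd_run T \<rho> r abar h \<eta> \<mu>0 \<gamma> x a \<longleftrightarrow>
     (\<exists>\<mu> B xt. \<mu> 1 = \<mu>0 \<and> B 1 = real T *\<^sub>R \<rho> \<and>
       (\<forall>t\<in>{1..T}.
          is_arg_max (\<lambda>y. reward (\<gamma> t) y - \<mu> t \<bullet> consumption (\<gamma> t) y) (\<lambda>y. y \<in> decisions (\<gamma> t)) (xt t) \<and>
          x t = (if consumption (\<gamma> t) (xt t) \<le> B t then xt t else 0) \<and>
          B (Suc t) = B t - consumption (\<gamma> t) (x t) \<and>
          a t \<in> reg_argmax \<rho> r (\<mu> t) \<and> infnorm (a t) \<le> abar \<and>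
          is_arg_min
            (\<lambda>\<nu>. (- consumption (\<gamma> t) (x t) + a t) \<bullet> \<nu> + 1 / \<eta> * bregman (dual_dom \<rho> r) h \<nu> (\<mu> t))
            (\<lambda>\<nu>. \<nu> \<in> dual_dom \<rho> r) (\<mu> (Suc t))))"

definition dual_mirror_descent ::
  "('d::finite, 'm::finite) request set \<Rightarrow> nat \<Rightarrow> real ^ 'm \<Rightarrow> (real ^ 'm \<Rightarrow> real) \<Rightarrow> real \<Rightarrow>
   (real ^ 'm \<Rightarrow> real) \<Rightarrow> real \<Rightarrow> real ^ 'm \<Rightarrow>
   ('d, 'm, real ^ 'd) online_rule \<Rightarrow> ('d, 'm, real ^ 'm) online_rule \<Rightarrow> bool"
  where "dual_mirror_descent S T \<rho> r abar h \<eta> \<mu>0 A a \<longleftrightarrow>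
     (\<forall>\<gamma>\<in>{1..T} \<rightarrow>\<^sub>E S. dmd_run T \<rho> r abar h \<eta> \<mu>0 \<gamma> (play A \<gamma>) (play a \<gamma>))"

text \<open>
  The rewards, the consumptions and the vectors \<open>a\<close> are random variables, adapted to the requests.
\<close>

definition measurable_run ::
  "('d::finite, 'm::finite) request measure \<Rightarrow> nat \<Rightarrow>
   ('d, 'm, real ^ 'd) online_rule \<Rightarrow> ('d, 'm, real ^ 'm) online_rule \<Rightarrow> bool"
  where "measurable_run M T A a \<longleftrightarrow>
     (\<forall>t\<in>{1..T}.
        (\<lambda>\<omega>. reward (\<omega> t) (A t \<omega>)) \<in> borel_measurable (\<Pi>\<^sub>M s\<in>{1..t}. M) \<and>
        (\<lambda>\<omega>. consumption (\<omega> t) (A t \<omega>)) \<in> borel_measurable (\<Pi>\<^sub>M s\<in>{1..t}. M) \<and>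
        a t \<in> borel_measurable (\<Pi>\<^sub>M s\<in>{1..t}. M))"

end

theory Submission
  imports Defs
begin

text \<open>
  Stop the process at the last period \<open>\<tau>\<close> before some resource \<open>j\<close> could run out. Until then every
  action maximizes the Lagrangian at the current dual variable, which depends on past requests only;
  since every fixed dual variable bounds the optimum by weak duality, the expected dual value per
  period is at least \<open>OPT / T\<close>. The reward collected differs from the dual values by the linear terms
  \<open>\<mu>\<^sub>t \<bullet> g\<^sub>t\<close>, which mirror descent compares with \<open>\<mu> \<bullet> g\<^sub>t\<close> for any fixed \<open>\<mu>\<close>. A supergradient of
  \<open>r\<close> at the average consumption, raised by \<open>K\<close> in coordinate \<open>j\<close> if \<open>\<tau> < T\<close>, makes the latter pay
  for the regularizer and for the periods after \<open>\<tau>\<close>. The dual iterates are measurable because the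
  minimizers are unique and Lipschitz in the linear term, and they stay at points where \<open>h\<close> is
  differentiable.
\<close>

subsection \<open>Norms and supergradients\<close>

text \<open>The stopping time depends on the path, and the vectors \<open>a\<close> may react to the
  current request. Both are absorbed without filtrations or optional stopping. The quantity
  \<open>Z\<close> is the dual value of a period while \<open>active\<close> holds and
  \<open>fbar + rbar\<close> afterwards; since \<open>OPT\<close> never exceeds
  \<open>T * (fbar + rbar)\<close>, each single period satisfies E[OPT] \<le> T * E[Z]. To see this
  for period t, all other coordinates are fixed, later ones included. The dual variable and
  \<open>active\<close> do not involve coordinate t, so \<open>Z\<close> becomes a function
  \<open>W\<close> of one request. The same \<open>W\<close>, applied to every coordinate of an
  i.i.d. sequence, bounds \<open>OPT\<close> by weak duality, and its integral is the same for each
  coordinate. The optimal Lagrangian value is never formed as a supremum: the value realized by the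
  run stands in for it, so its measurability follows from that of the run. The surrogate
  \<open>fbar + rbar\<close> also explains the size of \<open>K\<close>: each period after \<tau>
  costs this amount plus \<open>L * bbar\<close> from the supergradient comparison.\<close>

lemma l1norm_nonneg: "0 \<le> l1norm v"
  by (simp add: l1norm_def sum_nonneg)

lemma l1norm_triangle: "l1norm (u + v) \<le> l1norm u + l1norm v"
  unfolding l1norm_def sum.distrib[symmetric] by (rule sum_mono) simp

lemma l1norm_minus_commute: "l1norm (u - v) = l1norm (v - u)"
  by (simp add: l1norm_def abs_minus_commute)

lemma norm_le_l1norm: "norm v \<le> l1norm v"
  unfolding l1norm_def by (rule norm_le_l1_cart)

lemma l1norm_axis: "l1norm (axis j c) = \<bar>c\<bar>"
proof -
  have "l1norm (axis j c) = (\<Sum>i\<in>UNIV. if i = j then \<bar>c\<bar> else 0)"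
    unfolding l1norm_def by (rule sum.cong) (auto simp: axis_def)
  then show ?thesis by simp
qed

lemma inner_le_l1norm_infnorm: "\<bar>u \<bullet> v\<bar> \<le> l1norm u * infnorm v"
proof -
  have "\<bar>u \<bullet> v\<bar> \<le> (\<Sum>j\<in>UNIV. \<bar>u $ j * v $ j\<bar>)"
    unfolding inner_vec_def by (simp add: sum_abs)
  also have "\<dots> \<le> (\<Sum>j\<in>UNIV. \<bar>u $ j\<bar> * infnorm v)"
    unfolding abs_mult by (intro sum_mono mult_left_mono component_le_infnorm_cart) simp
  finally show ?thesis by (simp add: l1norm_def sum_distrib_right)
qed

lemma infnorm_leI:
  fixes v :: "real ^ 'm"
  assumes "\<And>j. \<bar>v $ j\<bar> \<le> c"
  shows "infnorm v \<le> c"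
  unfolding infnorm_cart using assms by (intro cSup_least) auto

text \<open>Both vectors lie in the box between 0 and \<open>c\<close>, so the factor 2 of the
  triangle inequality is avoided; \<open>K\<close> contains only one
  \<open>L * bbar\<close>.\<close>

lemma infnorm_diff_le:
  fixes u v :: "real ^ 'm"
  assumes "0 \<le> u" "0 \<le> v" "infnorm u \<le> c" "\<And>j. v $ j \<le> c"
  shows "infnorm (u - v) \<le> c"
proof (rule infnorm_leI)
  fix j
  have "u $ j \<le> c" using component_le_infnorm_cart[of u j] assms(3) by linarith
  then show "\<bar>(u - v) $ j\<bar> \<le> c"
    using assms(1,2)[unfolded less_eq_vec_def, rule_format, of j] assms(4)[of j] by simp
qed

lemma inner_mono_nonneg:
  fixes u v w :: "real ^ 'm"
  assumes "0 \<le> w" "u \<le> v"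
  shows "w \<bullet> u \<le> w \<bullet> v"
  unfolding inner_vec_def using assms
  by (intro sum_mono) (simp add: less_eq_vec_def mult_left_mono)

lemma nonneg_scaleR_vec: "0 \<le> c \<Longrightarrow> 0 \<le> v \<Longrightarrow> 0 \<le> c *\<^sub>R (v :: real ^ 'm)"
  by (simp add: less_eq_vec_def)

lemma borel_measurable_vec_iff:
  fixes f :: "'x \<Rightarrow> real ^ 'm::finite"
  shows "f \<in> borel_measurable N \<longleftrightarrow> (\<forall>j. (\<lambda>\<omega>. f \<omega> $ j) \<in> borel_measurable N)"
  by (subst borel_measurable_euclidean_space) (auto simp: Basis_vec_def inner_axis)

text \<open>Duality of the two norms: the sign vector \<open>?w\<close> is the direction in which
  the functional \<open>p\<close> attains its l1 norm.\<close>

lemma l1norm_leI: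
  fixes p :: "real ^ 'm"
  assumes L: "0 \<le> L" and p: "\<And>w. p \<bullet> w \<le> L * infnorm w"
  shows "l1norm p \<le> L"
proof -
  let ?w = "\<chi> j. sgn (p $ j)"
  have "l1norm p = p \<bullet> ?w"
    unfolding l1norm_def inner_vec_def by (intro sum.cong) (auto simp: abs_sgn)
  also have "\<dots> \<le> L * infnorm ?w" by (rule p)
  also have "\<dots> \<le> L * 1"
    using L by (intro mult_left_mono infnorm_leI) (auto simp: sgn_if)
  finally show ?thesis by simp
qed

lemma convex_cone_above:
  fixes b :: "real ^ 'm"
  assumes "0 \<le> L"
  shows "convex {(v, s). c + L * infnorm (v - b) < (s::real)}"
proof (rule convexI, clarsimp)
  fix v1 s1 v2 s2 and u w :: real
  assume 1: "c + L * infnorm (v1 - b) < s1" and 2: "c + L * infnorm (v2 - b) < s2"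
    and uw: "0 \<le> u" "0 \<le> w" "u + w = 1"
  have b: "b = u *\<^sub>R b + w *\<^sub>R b"
    using uw by (simp add: scaleR_add_left[symmetric])
  have "u *\<^sub>R v1 + w *\<^sub>R v2 - b = u *\<^sub>R (v1 - b) + w *\<^sub>R (v2 - b)"
    by (subst b) (simp add: algebra_simps)
  then have "infnorm (u *\<^sub>R v1 + w *\<^sub>R v2 - b) \<le> u * infnorm (v1 - b) + w * infnorm (v2 - b)"
    using infnorm_triangle[of "u *\<^sub>R (v1 - b)" "w *\<^sub>R (v2 - b)"] uw
    by (simp add: infnorm_mul)
  then have "c + L * infnorm (u *\<^sub>R v1 + w *\<^sub>R v2 - b)
      \<le> c + L * (u * infnorm (v1 - b) + w * infnorm (v2 - b))"
    using assms by (simp add: mult_left_mono)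
  also have "\<dots> = u * (c + L * infnorm (v1 - b)) + w * (c + L * infnorm (v2 - b))"
  proof -
    have "c = u * c + w * c" using uw by (metis distrib_right mult_1)
    then show ?thesis by (simp add: algebra_simps)
  qed
  also have "\<dots> < u * s1 + w * s2"
  \<comment> \<open>Strictness has to come from a summand with positive weight.\<close>
  proof (cases "u = 0")
    case True
    then show ?thesis using 2 uw by simp
  next
    case False
    then have "u * (c + L * infnorm (v1 - b)) < u * s1" using 1 uw by simp
    moreover have "w * (c + L * infnorm (v2 - b)) \<le> w * s2" using 2 uw by (simp add: mult_left_mono)
    ultimately show ?thesis by linarith
  qed
  finally show "c + L * infnorm (u *\<^sub>R v1 + w *\<^sub>R v2 - b) < u * s1 + w * s2" .
qed

text \<open>
  The hypograph of \<open>r\<close> is separated from the open cone of slope \<open>L\<close> above \<open>(b, r b)\<close>; the cone forces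
  the separating functional to be non-vertical and bounds its slope, also when \<open>b\<close> is on the
  boundary of \<open>S\<close>.
\<close>

lemma concave_lipschitz_supergradient:
  fixes r :: "real ^ 'm \<Rightarrow> real"
  assumes conc: "concave_on S r" and L: "0 \<le> L"
    and lip: "\<And>u v. u \<in> S \<Longrightarrow> v \<in> S \<Longrightarrow> \<bar>r u - r v\<bar> \<le> L * infnorm (u - v)"
    and b: "b \<in> S"
  obtains p where "l1norm p \<le> L" "\<And>v. v \<in> S \<Longrightarrow> r v + p \<bullet> v \<le> r b + p \<bullet> b"
proof -
  define H where "H = {(v, s). v \<in> S \<and> s \<le> r v}"
  define E where "E = {(v, s). r b + L * infnorm (v - b) < s}"
  have "convex H"
  proof -
    have "convex_on S (\<lambda>v. - r v)" using conc by (simp add: concave_on_def)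
    then have "convex (epigraph S (\<lambda>v. - r v))" by (simp add: convex_epigraph)
    then have "convex ((\<lambda>(v, s). (v, - s)) ` epigraph S (\<lambda>v. - r v))"
      by (rule convex_linear_image[rotated]) (auto intro!: linearI simp: scaleR_prod_def)
    also have "(\<lambda>(v, s). (v, - s)) ` epigraph S (\<lambda>v. - r v) = H"
      by (force simp: epigraph_def H_def image_iff intro: exI[of _ "- s" for s])
    finally show ?thesis .
  qed
  moreover have "convex E" unfolding E_def by (rule convex_cone_above[OF L])
  moreover have "(b, r b) \<in> H" "(b, r b + 1) \<in> E"
    using b by (auto simp: H_def E_def infnorm_0)
  then have "H \<noteq> {}" "E \<noteq> {}" by auto
  moreover have "H \<inter> E = {}"
  proof -
    have "False" if "v \<in> S" "s \<le> r v" "r b + L * infnorm (v - b) < s" for v s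
      using lip[OF that(1) b] that by linarith
    then show ?thesis by (auto simp: H_def E_def)
  qed
  ultimately obtain pq c where pq: "pq \<noteq> 0" "\<forall>z\<in>H. pq \<bullet> z \<le> c" "\<forall>z\<in>E. pq \<bullet> z \<ge> c"
    using separating_hyperplane_sets[of H E] by metis
  obtain p q where pq_eq: "pq = (p, q)" by (cases pq)
  have hypo: "p \<bullet> v + q * r v \<le> c" if "v \<in> S" for v
    using pq(2) that by (auto simp: H_def pq_eq)
  have cone: "c \<le> p \<bullet> v + q * s" if "r b + L * infnorm (v - b) < s" for v s
    using pq(3) that by (auto simp: E_def pq_eq)
  have "q > 0"
  proof (rule ccontr)
    assume nq: "\<not> q > 0"
    have pb: "p \<bullet> b + q * r b \<le> c" by (rule hypo[OF b])
    have "q = 0"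
      using cone[of b "r b + 1"] pb nq by (auto simp: infnorm_0 distrib_left)
    \<comment> \<open>The cone lies above every point, so a vertical hyperplane cannot separate;
      testing above \<open>b - p\<close> forces \<open>p = 0\<close>.\<close>
    moreover have "p \<bullet> p \<le> 0"
      using cone[of "b - p" "r b + L * infnorm ((b - p) - b) + 1"] pb \<open>q = 0\<close>
      by (simp add: inner_diff_right)
    then have "p = 0" by (meson inner_gt_zero_iff not_less)
    ultimately show False using pq(1) pq_eq by (simp add: zero_prod_def)
  qed
  \<comment> \<open>Lowering the height to the boundary of the cone extends the separation to the
    closed cone.\<close>
  have cone_le: "c \<le> p \<bullet> v + q * (r b + L * infnorm (v - b))" for v
  proof (rule field_le_epsilon)
    fix e :: real assume "0 < e"
    then show "c \<le> p \<bullet> v + q * (r b + L * infnorm (v - b)) + e"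
      using cone[of v "r b + L * infnorm (v - b) + e / q"] \<open>q > 0\<close>
      by (simp add: distrib_left)
  qed
  define p' where "p' = (1 / q) *\<^sub>R p"
  have p': "p \<bullet> v = q * (p' \<bullet> v)" for v using \<open>q > 0\<close> by (simp add: p'_def)
  show ?thesis
  proof (rule that)
    show "r v + p' \<bullet> v \<le> r b + p' \<bullet> b" if "v \<in> S" for v
    proof -
      have "q * (r v + p' \<bullet> v) \<le> q * (r b + p' \<bullet> b)"
        using hypo[OF that] cone_le[of b] by (simp add: p' infnorm_0 distrib_left)
      then show ?thesis using \<open>q > 0\<close> by simp
    qed
    show "l1norm p' \<le> L"
    proof (rule l1norm_leI[OF L])
      fix w
      have "q * (r b + p' \<bullet> b) \<le> q * (p' \<bullet> (b - w) + (r b + L * infnorm w))"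
        using hypo[OF b] cone_le[of "b - w"] by (simp add: p' distrib_left infnorm_neg)
      then have "r b + p' \<bullet> b \<le> p' \<bullet> (b - w) + (r b + L * infnorm w)"
        using \<open>q > 0\<close> by simp
      then show "p' \<bullet> w \<le> L * infnorm w" by (simp add: inner_diff_right)
    qed
  qed
qed

subsection \<open>The dual domain\<close>

lemma mem_dual_dom_iff: "\<mu> \<in> dual_dom \<rho> r \<longleftrightarrow> (\<exists>c. \<forall>v\<le>\<rho>. r v + \<mu> \<bullet> v \<le> c)"
proof
  assume "\<mu> \<in> dual_dom \<rho> r"
  then have lt: "(SUP v\<in>{..\<rho>}. ereal (r v + \<mu> \<bullet> v)) < \<infinity>"
    by (simp add: dual_dom_def reg_conj_def)
  \<comment> \<open>The point \<open>\<rho>\<close> is admissible, which excludes the value minus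
    infinity and leaves a real supremum.\<close>
  have "ereal (r \<rho> + \<mu> \<bullet> \<rho>) \<le> (SUP v\<in>{..\<rho>}. ereal (r v + \<mu> \<bullet> v))"
    by (rule SUP_upper) simp
  then obtain c where c: "(SUP v\<in>{..\<rho>}. ereal (r v + \<mu> \<bullet> v)) = ereal c"
    using lt by (cases "SUP v\<in>{..\<rho>}. ereal (r v + \<mu> \<bullet> v)") auto
  have "r v + \<mu> \<bullet> v \<le> c" if "v \<le> \<rho>" for v
  proof -
    have "ereal (r v + \<mu> \<bullet> v) \<le> ereal c"
      unfolding c[symmetric] using that by (intro SUP_upper) simp
    then show ?thesis by simp
  qed
  then show "\<exists>c. \<forall>v\<le>\<rho>. r v + \<mu> \<bullet> v \<le> c" by blast
next
  assume "\<exists>c. \<forall>v\<le>\<rho>. r v + \<mu> \<bullet> v \<le> c"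
  then obtain c where c: "\<And>v. v \<le> \<rho> \<Longrightarrow> r v + \<mu> \<bullet> v \<le> c" by blast
  have "reg_conj \<rho> r (- \<mu>) \<le> ereal c"
    unfolding reg_conj_def using c by (intro SUP_least) auto
  then show "\<mu> \<in> dual_dom \<rho> r"
    unfolding dual_dom_def by (auto intro: le_less_trans)
qed

text \<open>Admissible points are bounded above by \<open>\<rho>\<close>, so raising the dual
  variable by \<open>w\<close> adds at most \<open>w \<bullet> \<rho>\<close> to the conjugate. This
  admits both the raised comparison point and forward difference quotients.\<close>

lemma dual_dom_add_nonneg:
  assumes "\<mu> \<in> dual_dom \<rho> r" "0 \<le> w"
  shows "\<mu> + w \<in> dual_dom \<rho> r"
proof -
  obtain c where c: "\<And>v. v \<le> \<rho> \<Longrightarrow> r v + \<mu> \<bullet> v \<le> c"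
    using assms(1) by (auto simp: mem_dual_dom_iff)
  have "r v + (\<mu> + w) \<bullet> v \<le> c + w \<bullet> \<rho>" if "v \<le> \<rho>" for v
    using c[OF that] inner_mono_nonneg[OF assms(2) that] by (simp add: inner_add_left)
  then show ?thesis by (auto simp: mem_dual_dom_iff)
qed

text \<open>Finiteness of the conjugate with a fixed bound is a closed condition; letting the bound
  vary makes the domain an F-sigma set, hence Borel.\<close>

lemma dual_dom_eq_Union:
  "dual_dom \<rho> r = (\<Union>n::nat. \<Inter>v\<in>{..\<rho>}. {\<mu>. v \<bullet> \<mu> \<le> real n - r v})"
proof (intro set_eqI iffI)
  fix \<mu> assume "\<mu> \<in> dual_dom \<rho> r"
  then obtain c where c: "\<And>v. v \<le> \<rho> \<Longrightarrow> r v + \<mu> \<bullet> v \<le> c"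
    by (auto simp: mem_dual_dom_iff)
  obtain n :: nat where "c \<le> real n" using real_arch_simple by blast
  then show "\<mu> \<in> (\<Union>n::nat. \<Inter>v\<in>{..\<rho>}. {\<mu>. v \<bullet> \<mu> \<le> real n - r v})"
    using c by (auto simp: inner_commute intro!: exI[of _ n]) (smt (verit))
next
  fix \<mu> assume "\<mu> \<in> (\<Union>n::nat. \<Inter>v\<in>{..\<rho>}. {\<mu>. v \<bullet> \<mu> \<le> real n - r v})"
  then show "\<mu> \<in> dual_dom \<rho> r"
    by (auto simp: mem_dual_dom_iff inner_commute le_diff_eq add.commute)
qed

lemma dual_dom_borel: "dual_dom \<rho> r \<in> sets borel"
proof -
  have "closed (\<Inter>v\<in>{..\<rho>}. {\<mu>. v \<bullet> \<mu> \<le> real n - r v})" for n :: nat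
    by (intro closed_INT ballI closed_halfspace_le)
  then show ?thesis
    unfolding dual_dom_eq_Union by (intro sets.countable_UN' borel_closed) auto
qed

lemma convex_dual_dom: "convex (dual_dom \<rho> r)"
proof (rule convexI)
  fix \<mu> \<nu> and u w :: real
  assume "\<mu> \<in> dual_dom \<rho> r" "\<nu> \<in> dual_dom \<rho> r" and uw: "0 \<le> u" "0 \<le> w" "u + w = 1"
  then obtain c d where c: "\<And>v. v \<le> \<rho> \<Longrightarrow> r v + \<mu> \<bullet> v \<le> c" and d: "\<And>v. v \<le> \<rho> \<Longrightarrow> r v + \<nu> \<bullet> v \<le> d"
    by (auto simp: mem_dual_dom_iff)
  have "r v + (u *\<^sub>R \<mu> + w *\<^sub>R \<nu>) \<bullet> v \<le> u * c + w * d" if "v \<le> \<rho>" for v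
  proof -
    have "u * (r v + \<mu> \<bullet> v) + w * (r v + \<nu> \<bullet> v) \<le> u * c + w * d"
      using c[OF that] d[OF that] uw by (intro add_mono mult_left_mono) auto
    moreover have "r v = u * r v + w * r v" using uw by (metis distrib_right mult_1)
    ultimately show ?thesis by (simp add: inner_add_left algebra_simps)
  qed
  then show "u *\<^sub>R \<mu> + w *\<^sub>R \<nu> \<in> dual_dom \<rho> r" by (auto simp: mem_dual_dom_iff)
qed

subsection \<open>Mirror steps\<close>

lemma has_derivative_grad:
  assumes "h differentiable (at x within D)"
  shows "(h has_derivative (\<lambda>v. grad D h x \<bullet> v)) (at x within D)"
proof -
  let ?F = "frechet_derivative h (at x within D)"
  have F: "(h has_derivative ?F) (at x within D)"
    using assms by (simp add: frechet_derivative_works)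
  then have lin: "linear ?F" by (rule has_derivative_linear)
  have "?F v = grad D h x \<bullet> v" for v
  proof -
    have "?F v = ?F (\<Sum>j\<in>UNIV. v $ j *s axis j 1)" by (simp add: basis_expansion)
    also have "\<dots> = (\<Sum>j\<in>UNIV. v $ j * ?F (axis j 1))"
      by (simp add: linear_sum[OF lin] linear_scale[OF lin] scalar_mult_eq_scaleR)
    finally show ?thesis by (simp add: grad_def inner_vec_def mult.commute)
  qed
  then have "?F = (\<lambda>v. grad D h x \<bullet> v)" by (rule ext)
  with F show ?thesis by simp
qed

lemma has_derivative_along_segment:
  assumes f: "(f has_derivative (\<lambda>v. g \<bullet> v)) (at x within D)"
    and seg: "\<And>s. s \<in> I \<Longrightarrow> x + s *\<^sub>R w \<in> D"
  shows "((\<lambda>s. f (x + s *\<^sub>R w)) has_real_derivative g \<bullet> w) (at 0 within I)"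
proof -
  have "((\<lambda>s. x + s *\<^sub>R w) has_derivative (\<lambda>s. s *\<^sub>R w)) (at 0 within I)"
    by (auto intro!: derivative_eq_intros)
  moreover have "(f has_derivative (\<lambda>v. g \<bullet> v))
      (at (x + 0 *\<^sub>R w) within (\<lambda>s. x + s *\<^sub>R w) ` I)"
    using f seg by (auto intro: has_derivative_subset)
  ultimately have "((\<lambda>s. f (x + s *\<^sub>R w)) has_derivative (\<lambda>s. g \<bullet> (s *\<^sub>R w))) (at 0 within I)"
    by (rule has_derivative_in_compose)
  then show ?thesis by (simp add: has_field_derivative_def mult.commute[of _ "g \<bullet> w"])
qed

text \<open>The minimizer may lie on the boundary of \<open>D\<close>, so only segments into
  \<open>D\<close> are tested: a negative derivative at 0 would produce a smaller value.\<close>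

lemma convex_min_first_order:
  fixes D :: "(real ^ 'm) set"
  assumes D: "convex D" "x \<in> D" "y \<in> D"
    and h: "h differentiable (at x within D)"
    and min: "\<And>z. z \<in> D \<Longrightarrow> h x - c \<bullet> x \<le> h z - c \<bullet> z"
  shows "0 \<le> (grad D h x - c) \<bullet> (y - x)"
proof (rule ccontr)
  assume "\<not> ?thesis"
  have seg: "x + s *\<^sub>R (y - x) \<in> D" if "s \<in> {0..1}" for s
    using convexD_alt[OF D, of s] that by (simp add: algebra_simps)
  have "((\<lambda>z. h z - c \<bullet> z) has_derivative (\<lambda>v. grad D h x \<bullet> v - c \<bullet> v)) (at x within D)"
    by (intro derivative_intros has_derivative_grad[OF h])
  then have "((\<lambda>z. h z - c \<bullet> z) has_derivative (\<lambda>v. (grad D h x - c) \<bullet> v)) (at x within D)"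
    by (simp add: inner_diff_left)
  from has_derivative_along_segment[OF this, of "{0..1}" "y - x"] seg
  have "((\<lambda>s. h (x + s *\<^sub>R (y - x)) - c \<bullet> (x + s *\<^sub>R (y - x))) has_real_derivative
      (grad D h x - c) \<bullet> (y - x)) (at 0 within {0..1})" by blast
  from has_real_derivative_neg_dec_right[OF this] \<open>\<not> ?thesis\<close>
  obtain d where d: "d > 0" "\<And>s. s > 0 \<Longrightarrow> s \<in> {0..1} \<Longrightarrow> s < d \<Longrightarrow>
      h (x + s *\<^sub>R (y - x)) - c \<bullet> (x + s *\<^sub>R (y - x)) < h x - c \<bullet> x"
    by auto
  define s where "s = min 1 (d / 2)"
  have s: "s > 0" "s \<in> {0..1}" "s < d" using d(1) by (auto simp: s_def min_def)
  show False using d(2)[OF s] min[OF seg[OF s(2)]] by simp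
qed

locale mirror_map =
  fixes D :: "(real ^ 'm::finite) set" and h :: "real ^ 'm \<Rightarrow> real" and \<sigma> :: real
  assumes convex: "convex D"
    and smooth: "h differentiable_on D \<or> essentially_smooth_in D h"
    and strongly_convex: "\<sigma> > 0" "strongly_convex_in \<sigma> D h"
begin

text \<open>The strong convexity hypothesis is available only at these points, so every iterate has
  to be located in this set.\<close>

definition "smooth_points = {x \<in> D. h differentiable (at x within D)}"

lemma strong_convexity:
  assumes "x \<in> D" "y \<in> smooth_points"
  shows "h y + grad D h y \<bullet> (x - y) + \<sigma> / 2 * (l1norm (x - y))\<^sup>2 \<le> h x"
  using strongly_convex(2) assms by (simp add: strongly_convex_in_def smooth_points_def)

lemma gradient_inequality:
  assumes "x \<in> D" "y \<in> smooth_points"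
  shows "h y + grad D h y \<bullet> (x - y) \<le> h x"
proof -
  have "0 \<le> \<sigma> / 2 * (l1norm (x - y))\<^sup>2" using strongly_convex(1) by simp
  then show ?thesis using strong_convexity[OF assms] by linarith
qed

lemma interior_smooth:
  assumes "essentially_smooth_in D h" "x \<in> interior D"
  shows "x \<in> smooth_points"
proof -
  have "h differentiable_on interior D" using assms(1) by (simp add: essentially_smooth_in_def)
  then have "h differentiable (at x within interior D)"
    using assms(2) by (simp add: differentiable_on_def)
  also have "at x within interior D = at x within D"
    using assms(2) by (metis at_within_interior interior_interior)
  finally show ?thesis
    using assms(2) interior_subset by (auto simp: smooth_points_def)
qed

text \<open>
  Essential smoothness rules out subgradients at boundary points: approaching such a point along a
  segment from an interior point, the gradients of \<open>h - c\<close> would have a nonnegative component in the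
  direction of the segment and hence, by the gradient inequality on a ball, stay bounded.
\<close>

lemma subgradient_imp_interior:
  assumes es: "essentially_smooth_in D h" and a: "a \<in> D"
    and min: "\<And>z. z \<in> D \<Longrightarrow> h a - c \<bullet> a \<le> h z - c \<bullet> z"
  shows "a \<in> interior D"
proof (rule ccontr)
  assume na: "a \<notin> interior D"
  obtain x where x: "x \<in> interior D" using es by (auto simp: essentially_smooth_in_def)
  then obtain e where e: "e > 0" "cball x e \<subseteq> interior D"
    using open_contains_cball[of "interior D"] by auto
  have cont: "continuous_on (cball x e) (\<lambda>z. h z - c \<bullet> z)"
    using es e(2) by (auto simp: essentially_smooth_in_def
        intro!: continuous_intros intro: continuous_on_subset differentiable_imp_continuous_on)
  then have "bdd_above ((\<lambda>z. h z - c \<bullet> z) ` cball x e)"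
    by (intro bounded_imp_bdd_above compact_imp_bounded compact_continuous_image) auto
  then obtain N where "\<forall>v\<in>(\<lambda>z. h z - c \<bullet> z) ` cball x e. v \<le> N"
    unfolding bdd_above_def by (elim exE)
  then have N: "h z - c \<bullet> z \<le> N" if "z \<in> cball x e" for z using that by simp
  \<comment> \<open>The segment starts at the interior point, \<open>s 0 = x\<close>, and stays in
    the interior before its limit \<open>a\<close>.\<close>
  define s where "s n = a - inverse (real (Suc n)) *\<^sub>R (a - x)" for n
  have s_int: "s n \<in> interior D" for n
    unfolding s_def
    by (rule mem_interior_convex_shrink[OF convex x a]) (auto simp: field_simps)
  have "s \<longlonglongrightarrow> a - 0 *\<^sub>R (a - x)"
    unfolding s_def by (intro tendsto_intros LIMSEQ_inverse_real_of_nat)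
  then have lim: "s \<longlonglongrightarrow> a" by simp
  have "a \<in> frontier D" using a na closure_subset by (auto simp: frontier_def)
  then have "filterlim (\<lambda>n. norm (grad D h (s n))) at_top sequentially"
    using es s_int lim by (auto simp: essentially_smooth_in_def)
  moreover have "norm (grad D h (s n)) \<le> norm c + (N - (h a - c \<bullet> a)) / e" for n
  proof -
    define G where "G = grad D h (s n) - c"
    have sm: "s n \<in> smooth_points" by (rule interior_smooth[OF es s_int])
    have sD: "s n \<in> D" using s_int interior_subset by blast
    have grad: "h (s n) - c \<bullet> s n + G \<bullet> (z - s n) \<le> h z - c \<bullet> z" if "z \<in> D" for z
      using gradient_inequality[OF that sm] by (simp add: G_def algebra_simps)
    define k where "k = inverse (real (Suc n))"
    have k: "0 < k" "k \<le> 1" by (auto simp: k_def field_simps)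
    have s_eq: "s n = a - k *\<^sub>R (a - x)" by (simp only: s_def k_def)
    then have "G \<bullet> (a - s n) = k * (G \<bullet> (a - x))" by simp
    then have "k * (G \<bullet> (a - x)) \<le> 0"
      using grad[OF a] min[OF sD] by linarith
    then have "G \<bullet> (a - x) \<le> 0" using k by (simp add: mult_le_0_iff)
    moreover have "x - s n = - (1 - k) *\<^sub>R (a - x)"
      unfolding s_eq by (simp add: algebra_simps)
    ultimately have Gx: "0 \<le> G \<bullet> (x - s n)"
      using k by (simp add: mult_nonpos_nonpos)
    have "e * norm G \<le> N - (h a - c \<bullet> a)"
    proof -
      \<comment> \<open>The point of the ball furthest in the direction of \<open>G\<close>: the
        gradient inequality there isolates \<open>e * norm G\<close>, since the remaining term
        \<open>G \<bullet> (x - s n)\<close> is nonnegative.\<close>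
      define y where "y = x + e *\<^sub>R sgn G"
      have y: "y \<in> cball x e"
        using e(1) by (simp add: y_def dist_norm norm_sgn)
      then have "y \<in> D" using e(2) interior_subset by blast
      have "G \<bullet> sgn G = norm G"
        by (cases "G = 0") (simp_all add: sgn_div_norm dot_square_norm power2_eq_square)
      then have "G \<bullet> (y - s n) = e * norm G + G \<bullet> (x - s n)"
        by (simp add: y_def inner_add_right inner_diff_right)
      then show ?thesis
        using grad[OF \<open>y \<in> D\<close>] N[OF y] Gx min[OF sD] by linarith
    qed
    then have "norm G \<le> (N - (h a - c \<bullet> a)) / e" using e(1) by (simp add: field_simps)
    moreover have "norm (grad D h (s n)) \<le> norm G + norm c"
      using norm_triangle_ineq[of G c] by (simp add: G_def)
    ultimately show ?thesis by linarith
  qed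
  ultimately have "\<forall>\<^sub>F n::nat in sequentially. False"
    unfolding filterlim_at_top_dense
    by (auto elim!: allE[of _ "norm c + (N - (h a - c \<bullet> a)) / e"] eventually_mono simp: not_less[symmetric])
  then show False by simp
qed

text \<open>By the gradient inequality, a gradient within \<open>D\<close> is a subgradient, which
  essential smoothness permits in the interior only. In both cases \<open>smooth_points\<close> is a
  Borel set on which \<open>h\<close> is continuous.\<close>

lemma smooth_points_cases:
  "(h differentiable_on D \<and> smooth_points = D) \<or>
   (h differentiable_on interior D \<and> smooth_points = interior D)"
proof (cases "h differentiable_on D")
  case True
  then show ?thesis by (auto simp: smooth_points_def differentiable_on_def)
next
  case False
  then have es: "essentially_smooth_in D h" using smooth by blast
  have "x \<in> interior D" if x: "x \<in> smooth_points" for x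
  proof (rule subgradient_imp_interior[OF es])
    show "x \<in> D" using x by (simp add: smooth_points_def)
    show "h x - grad D h x \<bullet> x \<le> h z - grad D h x \<bullet> z" if "z \<in> D" for z
      using gradient_inequality[OF that x] by (simp add: inner_diff_right)
  qed
  then have "smooth_points = interior D" using interior_smooth[OF es] by blast
  then show ?thesis using es by (simp add: essentially_smooth_in_def)
qed

text \<open>Here \<open>x\<close> attains the convex conjugate of \<open>h\<close> on
  \<open>D\<close> at the slope \<open>c\<close>. Isolating the linear term allows minimizers to be
  compared for different slopes.\<close>

definition "is_mirror c x \<longleftrightarrow> x \<in> D \<and> (\<forall>z\<in>D. h x - c \<bullet> x \<le> h z - c \<bullet> z)"

text \<open>Minimality says that \<open>c\<close> is a subgradient at \<open>x\<close>, which in the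
  essentially smooth case excludes the boundary.\<close>

lemma mirror_smooth:
  assumes "is_mirror c x"
  shows "x \<in> smooth_points"
proof (cases "h differentiable_on D")
  case True
  then show ?thesis using assms by (auto simp: is_mirror_def smooth_points_def differentiable_on_def)
next
  case False
  then have "essentially_smooth_in D h" using smooth by blast
  then show ?thesis
    using assms subgradient_imp_interior[of x c] interior_smooth by (auto simp: is_mirror_def)
qed

lemma mirror_first_order:
  assumes "is_mirror c x" "y \<in> D"
  shows "0 \<le> (grad D h x - c) \<bullet> (y - x)"
  using assms mirror_smooth[OF assms(1)] convex_min_first_order[OF convex, of x y h c]
  by (auto simp: is_mirror_def smooth_points_def)

lemma mirror_strong:
  assumes "is_mirror c x" "y \<in> D"
  shows "h x + c \<bullet> (y - x) + \<sigma> / 2 * (l1norm (y - x))\<^sup>2 \<le> h y"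
  using mirror_first_order[OF assms] strong_convexity[OF assms(2) mirror_smooth[OF assms(1)]]
  by (simp add: inner_diff_left)

text \<open>In the sum of the strong convexity inequalities from \<open>x\<close> to
  \<open>y\<close> and back, the values of \<open>h\<close> cancel and the two halves of \<sigma>
  add up.\<close>

lemma mirror_monotone:
  assumes "is_mirror c x" "is_mirror d y"
  shows "\<sigma> * (l1norm (x - y))\<^sup>2 \<le> (c - d) \<bullet> (x - y)"
proof -
  have "x \<in> D" "y \<in> D" using assms by (auto simp: is_mirror_def)
  then have "h x + c \<bullet> (y - x) + \<sigma> / 2 * (l1norm (x - y))\<^sup>2 \<le> h y"
    "h y + d \<bullet> (x - y) + \<sigma> / 2 * (l1norm (x - y))\<^sup>2 \<le> h x"
    using mirror_strong[OF assms(1), of y] mirror_strong[OF assms(2), of x]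
    by (simp_all add: l1norm_minus_commute[of y x])
  moreover have "c \<bullet> (y - x) = - (c \<bullet> (x - y))" by (simp add: inner_diff_right)
  ultimately show ?thesis unfolding inner_diff_left by linarith
qed

text \<open>Stated in the Euclidean norm because \<open>lipschitz_on\<close> refers to it; the
  source of both uniqueness and measurability of the minimizers.\<close>

lemma mirror_lipschitz:
  assumes "is_mirror c x" "is_mirror d y"
  shows "norm (x - y) \<le> norm (c - d) / \<sigma>"
proof -
  have "\<sigma> * (norm (x - y))\<^sup>2 \<le> \<sigma> * (l1norm (x - y))\<^sup>2"
    using strongly_convex(1) norm_le_l1norm by (intro mult_left_mono power_mono) auto
  also have "\<dots> \<le> norm (c - d) * norm (x - y)"
    using mirror_monotone[OF assms] norm_cauchy_schwarz order_trans by blast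
  finally have "norm (x - y) * (\<sigma> * norm (x - y)) \<le> norm (x - y) * norm (c - d)"
    by (simp add: power2_eq_square algebra_simps)
  then have "\<sigma> * norm (x - y) \<le> norm (c - d)"
    by (cases "x = y") (simp_all add: mult_le_cancel_left)
  then show ?thesis
    using strongly_convex(1) by (simp add: pos_le_divide_eq mult.commute)
qed

lemma mirror_unique: "is_mirror c x \<Longrightarrow> is_mirror c y \<Longrightarrow> x = y"
  using mirror_lipschitz[of c x c y] by simp

section \<open>Bregman divergence and a single step of mirror descent\<close>

lemma bregman_nonneg:
  assumes "x \<in> D" "y \<in> smooth_points"
  shows "0 \<le> bregman D h x y"
  using gradient_inequality[OF assms] by (simp add: bregman_def)

text \<open>Multiplied by \<eta>, the objective of the update differs from \<open>h \<nu> - (grad D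
  h \<mu> - \<eta> *\<^sub>R g) \<bullet> \<nu>\<close> by a constant only.\<close>

lemma is_mirror_step:
  assumes eta: "\<eta> > 0"
    and min: "is_arg_min (\<lambda>\<nu>. g \<bullet> \<nu> + 1 / \<eta> * bregman D h \<nu> \<mu>) (\<lambda>\<nu>. \<nu> \<in> D) \<mu>'"
  shows "is_mirror (grad D h \<mu> - \<eta> *\<^sub>R g) \<mu>'"
proof -
  have "h \<mu>' - (grad D h \<mu> - \<eta> *\<^sub>R g) \<bullet> \<mu>' \<le> h z - (grad D h \<mu> - \<eta> *\<^sub>R g) \<bullet> z" if "z \<in> D" for z
  proof -
    have "g \<bullet> \<mu>' + 1 / \<eta> * bregman D h \<mu>' \<mu> \<le> g \<bullet> z + 1 / \<eta> * bregman D h z \<mu>"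
      using min that by (auto simp: is_arg_min_def not_less)
    then have "\<eta> * (g \<bullet> \<mu>' + 1 / \<eta> * bregman D h \<mu>' \<mu>) \<le> \<eta> * (g \<bullet> z + 1 / \<eta> * bregman D h z \<mu>)"
      using eta by simp
    then show ?thesis
      using eta by (simp add: bregman_def algebra_simps)
  qed
  then show ?thesis using min by (auto simp: is_mirror_def is_arg_min_def)
qed

lemma mirror_step_inequality:
  assumes eta: "\<eta> > 0" and \<mu>: "\<mu> \<in> smooth_points" and \<nu>: "\<nu> \<in> D" and g: "infnorm g \<le> G"
    and step: "is_mirror (grad D h \<mu> - \<eta> *\<^sub>R g) \<mu>'"
  shows "g \<bullet> (\<mu> - \<nu>) \<le> \<eta> * (G\<^sup>2 / (2 * \<sigma>)) + (bregman D h \<nu> \<mu> - bregman D h \<nu> \<mu>') / \<eta>"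
proof -
  define n where "n = l1norm (\<mu>' - \<mu>)"
  have "\<mu>' \<in> D" using step by (simp add: is_mirror_def)
  have 1: "\<eta> * (g \<bullet> (\<mu>' - \<nu>)) \<le> (grad D h \<mu>' - grad D h \<mu>) \<bullet> (\<nu> - \<mu>')"
    using mirror_first_order[OF step \<nu>] by (simp add: algebra_simps)
  \<comment> \<open>The three-point identity of Bregman divergences.\<close>
  have 2: "(grad D h \<mu>' - grad D h \<mu>) \<bullet> (\<nu> - \<mu>')
      = bregman D h \<nu> \<mu> - bregman D h \<nu> \<mu>' - bregman D h \<mu>' \<mu>"
    by (simp add: bregman_def algebra_simps)
  have 3: "\<sigma> / 2 * n\<^sup>2 \<le> bregman D h \<mu>' \<mu>"
    using strong_convexity[OF \<open>\<mu>' \<in> D\<close> \<mu>] by (simp add: bregman_def n_def)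
  have 4: "g \<bullet> (\<mu> - \<mu>') \<le> n * G"
  proof -
    have "g \<bullet> (\<mu> - \<mu>') \<le> n * infnorm g"
      using inner_le_l1norm_infnorm[of "\<mu> - \<mu>'" g]
      by (simp add: n_def inner_commute l1norm_minus_commute[of \<mu>])
    also have "\<dots> \<le> n * G" using g by (simp add: n_def l1norm_nonneg mult_left_mono)
    finally show ?thesis .
  qed
  \<comment> \<open>Completing the square in \<open>n\<close>: the strong convexity of
    \<open>h\<close> pays for the move from \<mu> to \<mu>', and
    \<open>G\<^sup>2 / (2 * \<sigma>)\<close> is what becomes \<open>C2\<close>.\<close>
  have 5: "\<eta> * (n * G) - \<sigma> / 2 * n\<^sup>2 \<le> \<eta>\<^sup>2 * (G\<^sup>2 / (2 * \<sigma>))"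
  proof -
    have "0 \<le> (\<eta> * G - \<sigma> * n)\<^sup>2 / (2 * \<sigma>)" using strongly_convex(1) by simp
    then show ?thesis
      using strongly_convex(1) by (simp add: power2_eq_square field_simps)
  qed
  have "\<eta> * (g \<bullet> (\<mu> - \<nu>)) = \<eta> * (g \<bullet> (\<mu> - \<mu>')) + \<eta> * (g \<bullet> (\<mu>' - \<nu>))"
    by (simp add: algebra_simps)
  also have "\<dots> \<le> \<eta> * (n * G) + (bregman D h \<nu> \<mu> - bregman D h \<nu> \<mu>' - \<sigma> / 2 * n\<^sup>2)"
    using 1 2 3 4 eta by (intro add_mono) auto
  also have "\<dots> \<le> \<eta>\<^sup>2 * (G\<^sup>2 / (2 * \<sigma>)) + (bregman D h \<nu> \<mu> - bregman D h \<nu> \<mu>')"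
    using 5 by linarith
  also have "\<dots> = \<eta> * (\<eta> * (G\<^sup>2 / (2 * \<sigma>)) + (bregman D h \<nu> \<mu> - bregman D h \<nu> \<mu>') / \<eta>)"
    using eta by (simp add: power2_eq_square distrib_left)
  finally show ?thesis using eta by simp
qed

text \<open>A point is the minimizer for its own gradient, that is, the outcome of a step with
  \<open>g = 0\<close>; monotonicity compares the actual step with this trivial one.\<close>

lemma mirror_step_length:
  assumes eta: "\<eta> > 0" and \<mu>: "\<mu> \<in> smooth_points" and g: "infnorm g \<le> G"
    and step: "is_mirror (grad D h \<mu> - \<eta> *\<^sub>R g) \<mu>'"
  shows "l1norm (\<mu>' - \<mu>) \<le> \<eta> * G / \<sigma>"
proof -
  define n where "n = l1norm (\<mu>' - \<mu>)"
  have \<mu>D: "\<mu> \<in> D" using \<mu> by (simp add: smooth_points_def)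
  have "is_mirror (grad D h \<mu>) \<mu>"
    using gradient_inequality[OF _ \<mu>] \<mu>D by (fastforce simp: is_mirror_def inner_diff_right)
  from mirror_monotone[OF step this]
  have "\<sigma> * n\<^sup>2 \<le> \<eta> * - ((\<mu>' - \<mu>) \<bullet> g)" by (simp add: n_def inner_commute)
  also have "\<dots> \<le> \<eta> * (n * infnorm g)"
    using inner_le_l1norm_infnorm[of "\<mu>' - \<mu>" g] eta by (intro mult_left_mono) (auto simp: n_def)
  also have "\<dots> \<le> \<eta> * (n * G)"
    using g eta by (intro mult_left_mono) (auto simp: n_def l1norm_nonneg)
  finally have "n * (\<sigma> * n) \<le> n * (\<eta> * G)" by (simp add: power2_eq_square algebra_simps)
  moreover have "0 \<le> n" by (simp add: n_def l1norm_nonneg)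
  moreover have "0 \<le> G" using g infnorm_pos_le order_trans by blast
  ultimately have "\<sigma> * n \<le> \<eta> * G" using eta by (cases "n = 0") (auto simp: mult_le_cancel_left)
  then show ?thesis using strongly_convex(1) by (simp add: n_def[symmetric] field_simps)
qed

end

section \<open>Measurability of gradients and minimizers\<close>

locale orthant_mirror_map = mirror_map +
  assumes borel: "D \<in> sets borel"
    and add_nonneg: "\<And>x v. x \<in> D \<Longrightarrow> 0 \<le> v \<Longrightarrow> x + v \<in> D"
begin

text \<open>Ensures that forward difference quotients evaluate \<open>h\<close> only where it is
  known to be continuous.\<close>

lemma smooth_points_add_nonneg:
  assumes "x \<in> smooth_points" "0 \<le> v"
  shows "x + v \<in> smooth_points"
proof -
  have "x + v \<in> interior D" if x: "x \<in> interior D"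
  proof -
    obtain e where e: "e > 0" "ball x e \<subseteq> D" using x by (auto simp: mem_interior)
    have "ball (x + v) e \<subseteq> D"
    proof
      fix y assume "y \<in> ball (x + v) e"
      then have "y - v \<in> ball x e" by (simp add: dist_norm algebra_simps)
      then show "y \<in> D" using e(2) add_nonneg[of "y - v" v] assms(2) by auto
    qed
    then show ?thesis using e(1) by (auto simp: mem_interior)
  qed
  then show ?thesis using smooth_points_cases assms add_nonneg by auto
qed

lemma borel_smooth_points: "smooth_points \<in> sets borel"
  using smooth_points_cases borel by auto

lemma continuous_on_smooth_points: "continuous_on smooth_points h"
  using smooth_points_cases differentiable_imp_continuous_on by metis

text \<open>
  Since \<open>D\<close> is stable under adding \<open>axis j \<epsilon>\<close>, partial derivatives are limits of forward
  difference quotients inside \<open>D\<close>.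
\<close>

lemma grad_LIMSEQ:
  assumes "x \<in> smooth_points"
  shows "(\<lambda>n. (h (x + axis j (inverse (real (Suc n)))) - h x) * real (Suc n)) \<longlonglongrightarrow> grad D h x $ j"
proof -
  have x: "x \<in> D" "h differentiable (at x within D)" using assms by (auto simp: smooth_points_def)
  have "x + s *\<^sub>R axis j 1 \<in> D" if "s \<in> {0..}" for s :: real
    using that x(1) by (intro add_nonneg) (auto simp: less_eq_vec_def axis_def)
  from has_derivative_along_segment[OF has_derivative_grad[OF x(2)], of "{0..}", OF this]
  have "((\<lambda>s. h (x + s *\<^sub>R axis j 1)) has_real_derivative grad D h x $ j) (at 0 within {0..})"
    by (simp add: inner_axis)
  then have lim: "((\<lambda>s. (h (x + s *\<^sub>R axis j 1) - h x) / s) \<longlongrightarrow> grad D h x $ j) (at 0 within {0..})"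
    by (simp add: has_field_derivative_iff)
  have "filterlim (\<lambda>n. inverse (real (Suc n))) (at 0 within {0..}) sequentially"
    unfolding filterlim_at using LIMSEQ_inverse_real_of_nat by auto
  from filterlim_compose[OF lim this] show ?thesis
    by (simp add: divide_inverse axis_def scaleR_vec_def vec_eq_iff if_distrib cong: if_cong)
qed

text \<open>Nothing is known about \<open>h\<close> outside \<open>smooth_points\<close>, so it is
  cut off by the indicator of this Borel set before composing.\<close>

lemma measurable_h_comp:
  assumes f: "f \<in> borel_measurable N" and sm: "\<And>\<omega>. \<omega> \<in> space N \<Longrightarrow> f \<omega> \<in> smooth_points"
  shows "(\<lambda>\<omega>. h (f \<omega>)) \<in> borel_measurable N"
proof -
  have "(\<lambda>x. indicator smooth_points x *\<^sub>R h x) \<in> borel_measurable borel"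
    by (rule borel_measurable_continuous_on_indicator[OF borel_smooth_points continuous_on_smooth_points])
  from measurable_compose[OF f this]
  show ?thesis by (rule measurable_cong[THEN iffD1, rotated]) (simp add: sm)
qed

lemma measurable_grad_comp:
  assumes f: "f \<in> borel_measurable N" and sm: "\<And>\<omega>. \<omega> \<in> space N \<Longrightarrow> f \<omega> \<in> smooth_points"
  shows "(\<lambda>\<omega>. grad D h (f \<omega>)) \<in> borel_measurable N"
  unfolding borel_measurable_vec_iff
proof
  fix j
  show "(\<lambda>\<omega>. grad D h (f \<omega>) $ j) \<in> borel_measurable N"
  proof (rule borel_measurable_LIMSEQ_metric)
    show "(\<lambda>\<omega>. (h (f \<omega> + axis j (inverse (real (Suc n)))) - h (f \<omega>)) * real (Suc n)) \<in> borel_measurable N"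
      for n
      using f sm
      by (intro borel_measurable_times borel_measurable_diff borel_measurable_const measurable_h_comp
          borel_measurable_add smooth_points_add_nonneg) (auto simp: less_eq_vec_def axis_def)
  qed (rule grad_LIMSEQ[OF sm])
qed

text \<open>The set \<open>E\<close> of slopes that have a minimizer is not known to be Borel. The
  Lipschitz solution map therefore extends to the closure of \<open>E\<close>, where continuity
  gives a Borel function that agrees with \<open>u\<close> along \<open>c\<close>.\<close>

lemma measurable_mirror:
  assumes c: "c \<in> borel_measurable N" and u: "\<And>\<omega>. \<omega> \<in> space N \<Longrightarrow> is_mirror (c \<omega>) (u \<omega>)"
  shows "u \<in> borel_measurable N"
proof -
  define E where "E = {c. \<exists>x. is_mirror c x}"
  define \<Psi> where "\<Psi> c = (SOME x. is_mirror c x)" for c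
  have \<Psi>: "is_mirror c (\<Psi> c)" if "c \<in> E" for c
    using that someI_ex[of "is_mirror c"] by (simp add: E_def \<Psi>_def)
  have "(1 / \<sigma>)-lipschitz_on E \<Psi>"
    using strongly_convex(1) mirror_lipschitz[OF \<Psi> \<Psi>]
    by (intro lipschitz_onI) (auto simp: dist_norm)
  then obtain \<Psi>' where \<Psi>': "(1 / \<sigma>)-lipschitz_on (closure E) \<Psi>'" "\<And>x. x \<in> E \<Longrightarrow> \<Psi>' x = \<Psi> x"
    using lipschitz_extend_closure by blast
  have "(\<lambda>x. indicator (closure E) x *\<^sub>R \<Psi>' x) \<in> borel_measurable borel"
    using lipschitz_on_continuous_on[OF \<Psi>'(1)] by (intro borel_measurable_continuous_on_indicator) auto
  from measurable_compose[OF c this]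
  show ?thesis
  proof (rule measurable_cong[THEN iffD1, rotated])
    fix \<omega> assume "\<omega> \<in> space N"
    then have E: "c \<omega> \<in> E" using u by (auto simp: E_def)
    then have "\<Psi>' (c \<omega>) = u \<omega>"
      using \<Psi>'(2)[OF E] mirror_unique[OF \<Psi>[OF E] u[OF \<open>\<omega> \<in> space N\<close>]] by simp
    then show "indicator (closure E) (c \<omega>) *\<^sub>R \<Psi>' (c \<omega>) = u \<omega>"
      using E closure_subset[of E] by auto
  qed
qed

end

subsection \<open>Regret along a path\<close>

text \<open>
  As long as this holds, every consumption bounded by \<open>bbar\<close> is affordable in period \<open>t\<close>; the periods
  where it holds are those up to the stopping time \<open>\<tau>\<close>.
\<close>

definition active :: "nat \<Rightarrow> real \<Rightarrow> real ^ 'm::finite \<Rightarrow> (nat \<Rightarrow> real ^ 'm) \<Rightarrow> nat \<Rightarrow> bool" where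
  "active T bbar \<rho> b t \<longleftrightarrow> (\<forall>j. (\<Sum>s\<in>{1..<t}. b s $ j) + bbar \<le> real T * \<rho> $ j)"

lemma active_cong:
  assumes "\<And>s. s \<in> {1..<t} \<Longrightarrow> b s = b' s"
  shows "active T c \<rho> b t = active T c \<rho> b' t"
  using assms by (simp add: active_def)

lemma active_antimono:
  assumes "active T c \<rho> b t" "s \<le> t" "\<And>u. u \<in> {1..<t} \<Longrightarrow> 0 \<le> b u"
  shows "active T c \<rho> b s"
  unfolding active_def
proof
  fix j
  have "(\<Sum>u\<in>{1..<s}. b u $ j) \<le> (\<Sum>u\<in>{1..<t}. b u $ j)"
    using assms(2,3) by (intro sum_mono2) (auto simp: less_eq_vec_def)
  then show "(\<Sum>u\<in>{1..<s}. b u $ j) + c \<le> real T * \<rho> $ j"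
    using assms(1) by (auto simp: active_def intro: order_trans add_right_mono)
qed

text \<open>Produces the stopping time. The value \<tau> = 0 is possible: \<open>active\<close>
  fails at once if \<open>bbar\<close> exceeds the whole budget of some resource.\<close>

lemma initial_segment:
  fixes T :: nat
  assumes "\<And>s t. P t \<Longrightarrow> s \<le> t \<Longrightarrow> P s"
  obtains \<tau> where "\<tau> \<le> T" "\<And>t. t \<in> {1..T} \<Longrightarrow> P t \<longleftrightarrow> t \<le> \<tau>" "\<tau> < T \<Longrightarrow> \<not> P (Suc \<tau>)"
proof (cases "\<forall>t\<in>{1..T}. P t")
  case True
  then show ?thesis by (intro that[of T]) auto
next
  case False
  define k where "k = (LEAST t. t \<in> {1..T} \<and> \<not> P t)"
  have "\<exists>t. t \<in> {1..T} \<and> \<not> P t" using False by blast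
  from LeastI_ex[OF this] have k: "k \<in> {1..T}" "\<not> P k" unfolding k_def by blast+
  have "P t" if "t \<in> {1..T}" "t < k" for t
    using that not_less_Least[of t "\<lambda>t. t \<in> {1..T} \<and> \<not> P t"] by (auto simp: k_def)
  moreover have "\<not> P t" if "k \<le> t" for t using k(2) assms that by blast
  moreover obtain m where "k = Suc m" using k(1) by (cases k) auto
  ultimately have "P t \<longleftrightarrow> t \<le> m" if "t \<in> {1..T}" for t
    using that by (metis less_Suc_eq_le not_less_eq_eq)
  then show ?thesis using k \<open>k = Suc m\<close> by (intro that[of m]) auto
qed

locale allocation =
  fixes T :: nat and \<rho> :: "real ^ 'm::finite" and r h :: "real ^ 'm \<Rightarrow> real"
    and fbar bbar abar rbar L \<sigma> \<eta> :: real and \<mu>0 :: "real ^ 'm"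
  assumes T: "T \<ge> 1"
    and rho_pos: "\<And>j. \<rho> $ j > 0"
    and bounds_nonneg: "fbar \<ge> 0" "bbar \<ge> 0"
    and r_lipschitz:
      "\<And>a1 a2. a1 \<le> \<rho> \<Longrightarrow> a2 \<le> \<rho> \<Longrightarrow> \<bar>r a1 - r a2\<bar> \<le> L * infnorm (a1 - a2)"
    and r_argmax: "\<And>\<mu>. \<mu> \<in> dual_dom \<rho> r \<Longrightarrow> \<exists>v\<in>reg_argmax \<rho> r \<mu>. infnorm v \<le> abar"
    and r_bounded: "\<And>v. 0 \<le> v \<Longrightarrow> v \<le> \<rho> \<Longrightarrow> 0 \<le> r v \<and> r v \<le> rbar"
    and r_concave: "concave_on {..\<rho>} r"
    and h_smooth: "h differentiable_on dual_dom \<rho> r \<or> essentially_smooth_in (dual_dom \<rho> r) h"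
    and h_convex: "\<sigma> > 0" "strongly_convex_in \<sigma> (dual_dom \<rho> r) h"
    and eta_pos: "\<eta> > 0"
    and init: "\<mu>0 \<in> dual_dom \<rho> r" "h differentiable (at \<mu>0 within dual_dom \<rho> r)"
begin

sublocale orthant_mirror_map "dual_dom \<rho> r" h \<sigma>
  by unfold_locales (use h_smooth h_convex in \<open>auto simp: convex_dual_dom dual_dom_borel dual_dom_add_nonneg\<close>)

abbreviation "D \<equiv> dual_dom \<rho> r"

definition "K = (fbar + rbar + L * (bbar + abar)) / Min (range (\<lambda>j. \<rho> $ j))"

abbreviation "V \<equiv> bregman D h"

definition "drift = (bbar + abar)\<^sup>2 / (2 * \<sigma>)"

lemma rho_nonneg: "0 \<le> \<rho>"
  using rho_pos by (simp add: less_eq_vec_def less_imp_le)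

lemma L_nonneg: "0 \<le> L"
proof -
  obtain j :: 'm where True by blast
  let ?v = "\<rho> - axis j 1"
  have "?v \<le> \<rho>" by (simp add: less_eq_vec_def axis_def)
  then have "0 \<le> L * infnorm (axis j (1::real) :: real ^ 'm)"
    using r_lipschitz[of \<rho> ?v] by simp
  moreover have "0 < infnorm (axis j (1::real) :: real ^ 'm)"
    by (simp add: infnorm_pos_lt axis_eq_0_iff)
  ultimately show ?thesis by (simp add: zero_le_mult_iff)
qed

lemma abar_nonneg: "0 \<le> abar"
  using r_argmax[OF init(1)] infnorm_pos_le order_trans by blast

lemma rbar_nonneg: "0 \<le> rbar"
  using r_bounded[of 0] rho_nonneg by simp

lemma numerator_nonneg: "0 \<le> fbar + rbar + L * (bbar + abar)"
  using bounds_nonneg L_nonneg abar_nonneg rbar_nonneg by simp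

lemma rho_min: "0 < Min (range (\<lambda>j. \<rho> $ j))" "Min (range (\<lambda>j. \<rho> $ j)) \<le> \<rho> $ j"
  using rho_pos by auto

lemma K_nonneg: "0 \<le> K"
  unfolding K_def by (rule divide_nonneg_pos[OF numerator_nonneg rho_min(1)])

text \<open>With price \<open>K\<close> on a nearly exhausted resource, each period after stopping
  is credited \<open>K * \<rho> $ j\<close>, which has to cover its cost.\<close>

lemma K_rho: "fbar + rbar + L * (bbar + abar) \<le> K * \<rho> $ j"
proof -
  have "fbar + rbar + L * (bbar + abar) = K * Min (range (\<lambda>j. \<rho> $ j))"
    using less_imp_neq[OF rho_min(1)] unfolding K_def by (metis nonzero_eq_divide_eq)
  also have "\<dots> \<le> K * \<rho> $ j" using K_nonneg rho_min(2) by (rule mult_left_mono[rotated])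
  finally show ?thesis .
qed

lemma drift_nonneg: "0 \<le> drift"
  using h_convex(1) by (simp add: drift_def)

lemma init_smooth: "\<mu>0 \<in> smooth_points"
  using init by (simp add: smooth_points_def)

text \<open>The index is the period: \<open>dual_seq g 1 = \<mu>0\<close>.\<close>

primrec dual_seq :: "(nat \<Rightarrow> real ^ 'm) \<Rightarrow> nat \<Rightarrow> real ^ 'm" where
  "dual_seq g 0 = \<mu>0"
| "dual_seq g (Suc t) =
    (if t = 0 then \<mu>0 else THE \<mu>'. is_mirror (grad D h (dual_seq g t) - \<eta> *\<^sub>R g t) \<mu>')"

lemma dual_seq_1 [simp]: "dual_seq g (Suc 0) = \<mu>0"
  by simp

lemma dual_seq_cong:
  assumes "\<And>s. s \<in> {1..<t} \<Longrightarrow> g s = g' s"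
  shows "dual_seq g t = dual_seq g' t"
  using assms
proof (induction t)
  case (Suc t)
  then have "dual_seq g t = dual_seq g' t" by simp
  then show ?case using Suc.prems[of t] by (cases "t = 0") simp_all
qed simp

lemma dual_seq_SucI:
  assumes "t \<ge> 1" "is_mirror (grad D h (dual_seq g t) - \<eta> *\<^sub>R g t) \<mu>'"
  shows "dual_seq g (Suc t) = \<mu>'"
  using assms mirror_unique by (auto intro!: the_equality)

declare dual_seq.simps(2) [simp del]

text \<open>The \<open>THE\<close> in \<open>dual_seq\<close> has its intended value only if a
  minimizer exists. Existence is supplied by the run and recorded here.\<close>

definition dual_path :: "(nat \<Rightarrow> real ^ 'm) \<Rightarrow> bool" where
  "dual_path g \<longleftrightarrow>
     (\<forall>t\<in>{1..T}. is_mirror (grad D h (dual_seq g t) - \<eta> *\<^sub>R g t) (dual_seq g (Suc t)))"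

lemma dual_path_smooth:
  assumes "dual_path g" "t \<in> {1..Suc T}"
  shows "dual_seq g t \<in> smooth_points"
proof (cases "t = 1")
  case True
  then show ?thesis using init_smooth by simp
next
  case False
  then obtain s where "t = Suc s" "s \<in> {1..T}" using assms(2) by (cases t) auto
  then show ?thesis using assms(1) mirror_smooth unfolding dual_path_def by blast
qed

text \<open>The divergences telescope and the last one is nonnegative. Every prefix is covered
  because the stopping time varies with the path.\<close>

lemma dual_path_regret:
  assumes path: "dual_path g" and g: "\<And>t. t \<in> {1..T} \<Longrightarrow> infnorm (g t) \<le> bbar + abar"
    and \<nu>: "\<nu> \<in> D" and "\<tau> \<le> T"
  shows "(\<Sum>t\<in>{1..\<tau>}. g t \<bullet> (dual_seq g t - \<nu>)) \<le> real \<tau> * (\<eta> * drift) + V \<nu> \<mu>0 / \<eta>"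
proof -
  have "(\<Sum>t\<in>{1..\<tau>}. g t \<bullet> (dual_seq g t - \<nu>))
      \<le> real \<tau> * (\<eta> * drift) + (V \<nu> \<mu>0 - V \<nu> (dual_seq g (Suc \<tau>))) / \<eta>"
    using \<open>\<tau> \<le> T\<close>
  proof (induction \<tau>)
    case (Suc \<tau>)
    then have t: "Suc \<tau> \<in> {1..T}" by simp
    then have "g (Suc \<tau>) \<bullet> (dual_seq g (Suc \<tau>) - \<nu>)
        \<le> \<eta> * drift + (V \<nu> (dual_seq g (Suc \<tau>)) - V \<nu> (dual_seq g (Suc (Suc \<tau>)))) / \<eta>"
      using path dual_path_smooth[OF path] unfolding drift_def dual_path_def
      by (intro mirror_step_inequality[OF eta_pos _ \<nu> g[OF t]]) auto
    with Suc show ?case by (simp add: algebra_simps add_divide_distrib diff_divide_distrib)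
  qed simp
  moreover have "0 \<le> V \<nu> (dual_seq g (Suc \<tau>))"
    using dual_path_smooth[OF path, of "Suc \<tau>"] \<open>\<tau> \<le> T\<close> by (intro bregman_nonneg[OF \<nu>]) simp
  then have "0 \<le> V \<nu> (dual_seq g (Suc \<tau>)) / \<eta>" using eta_pos by (simp)
  ultimately show ?thesis unfolding diff_divide_distrib by linarith
qed

text \<open>A crude bound by adding up step lengths; it serves the integrability of the dual values
  and does not enter the regret constants.\<close>

lemma dual_path_bounded:
  assumes path: "dual_path g" and g: "\<And>t. t \<in> {1..T} \<Longrightarrow> infnorm (g t) \<le> bbar + abar"
    and "t \<in> {1..T}"
  shows "l1norm (dual_seq g t) \<le> l1norm \<mu>0 + real T * (\<eta> * (bbar + abar) / \<sigma>)"
proof -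
  let ?c = "\<eta> * (bbar + abar) / \<sigma>"
  have c: "0 \<le> ?c" using eta_pos bounds_nonneg abar_nonneg h_convex(1) by simp
  have "l1norm (dual_seq g (Suc s)) \<le> l1norm \<mu>0 + real s * ?c" if "s \<le> T" for s
    using that
  proof (induction s)
    case (Suc s)
    then have s: "Suc s \<in> {1..T}" by simp
    have "l1norm (dual_seq g (Suc (Suc s)) - dual_seq g (Suc s)) \<le> ?c"
      using s path dual_path_smooth[OF path] unfolding dual_path_def
      by (intro mirror_step_length[OF eta_pos _ g[OF s]]) auto
    then have "l1norm (dual_seq g (Suc (Suc s))) \<le> l1norm (dual_seq g (Suc s)) + ?c"
      using l1norm_triangle[of "dual_seq g (Suc s)" "dual_seq g (Suc (Suc s)) - dual_seq g (Suc s)"]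
      by (simp)
    moreover have "real (Suc s) * ?c = real s * ?c + ?c" by (simp add: distrib_right add_divide_distrib)
    moreover have "l1norm (dual_seq g (Suc s)) \<le> l1norm \<mu>0 + real s * ?c" using Suc by simp
    ultimately show ?case by linarith
  qed simp
  from this[of "t - 1"] have "l1norm (dual_seq g t) \<le> l1norm \<mu>0 + real (t - 1) * ?c"
    using \<open>t \<in> {1..T}\<close> by auto
  also have "\<dots> \<le> l1norm \<mu>0 + real T * ?c"
    using \<open>t \<in> {1..T}\<close> c by (intro add_left_mono mult_right_mono) auto
  finally show ?thesis .
qed

text \<open>Signs follow the dual convention: \<open>w\<close> maximizes
  \<open>r v + p \<bullet> v\<close>, so in the usual convention \<open>- p\<close> is the
  supergradient. The maximum being finite puts \<open>p\<close> into the dual domain.\<close>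

lemma supergradient:
  assumes "w \<le> \<rho>"
  obtains p where "l1norm p \<le> L" "p \<in> D" "\<And>v. v \<le> \<rho> \<Longrightarrow> r v + p \<bullet> v \<le> r w + p \<bullet> w"
proof -
  obtain p where p: "l1norm p \<le> L" "\<And>v. v \<in> {..\<rho>} \<Longrightarrow> r v + p \<bullet> v \<le> r w + p \<bullet> w"
    using concave_lipschitz_supergradient[OF r_concave L_nonneg, of w] r_lipschitz assms by auto
  then have "p \<in> D" by (auto simp: mem_dual_dom_iff)
  with p show ?thesis by (intro that) auto
qed

text \<open>
  The comparison point of mirror descent is a supergradient of \<open>r\<close> at the average consumption; if
  resource \<open>j\<close> is nearly exhausted after \<open>\<tau> < T\<close> periods, it is raised by \<open>K\<close> in coordinate \<open>j\<close>,
  which pays for the reward lost in the remaining periods.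
\<close>

lemma stopped_regret:
  fixes b a :: "nat \<Rightarrow> real ^ 'm"
  defines "g \<equiv> (\<lambda>t. a t - b t)"
  assumes b: "\<And>t. t \<in> {1..T} \<Longrightarrow> 0 \<le> b t" "\<And>t. t \<in> {1..T} \<Longrightarrow> infnorm (b t) \<le> bbar"
    and a: "\<And>t. t \<in> {1..T} \<Longrightarrow> a t \<le> \<rho>"
    and g: "\<And>t. t \<in> {1..T} \<Longrightarrow> infnorm (g t) \<le> bbar + abar"
    and path: "dual_path g"
    and budget: "(\<Sum>t\<in>{1..T}. b t) \<le> real T *\<^sub>R \<rho>"
    and c: "\<And>\<nu>. \<nu> \<in> D \<Longrightarrow> l1norm \<nu> \<le> L + K \<Longrightarrow> V \<nu> \<mu>0 \<le> c"
    and \<tau>: "\<tau> \<le> T" "\<tau> < T \<Longrightarrow> \<not> active T bbar \<rho> b (Suc \<tau>)"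
  shows "(\<Sum>t\<in>{1..\<tau>}. r (a t) + g t \<bullet> dual_seq g t) + real (T - \<tau>) * (fbar + rbar)
      - real T * r ((1 / real T) *\<^sub>R (\<Sum>t\<in>{1..T}. b t)) \<le> bbar * K + drift * \<eta> * real T + c / \<eta>"
proof -
  define w where "w = (1 / real T) *\<^sub>R (\<Sum>t\<in>{1..T}. b t)"
  define n where "n = real (T - \<tau>)"
  have T_eq: "real T = real \<tau> + n" "0 \<le> n" using \<tau>(1) by (auto simp: n_def)
  have T_pos: "real T > 0" using T by simp
  have b_le: "b t $ j \<le> bbar" if "t \<in> {1..T}" for t j
    using component_le_infnorm_cart[of "b t" j] b(2)[OF that] by linarith
  have w0: "0 \<le> w"
    unfolding w_def using b(1) by (auto simp: less_eq_vec_def intro!: divide_nonneg_nonneg sum_nonneg)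
  have w_rho: "w \<le> \<rho>"
    using budget T_pos by (auto simp: w_def less_eq_vec_def field_simps)
  have w_le: "w $ j \<le> bbar" for j
    using sum_bounded_above[of "{1..T}" "\<lambda>t. b t $ j" bbar] b_le T_pos
    by (simp add: w_def field_simps)
  have sum_b: "(\<Sum>t\<in>{1..T}. b t) = real T *\<^sub>R w" using T_pos by (simp add: w_def)
  obtain p where p: "l1norm p \<le> L" "p \<in> D" "\<And>v. v \<le> \<rho> \<Longrightarrow> r v + p \<bullet> v \<le> r w + p \<bullet> w"
    using supergradient[OF w_rho] by blast
  have r_w: "0 \<le> r w" using r_bounded w0 w_rho by blast
  have split: "{1..T} = {1..\<tau>} \<union> {Suc \<tau>..T}" using \<tau>(1) by auto
  have sum_split: "(\<Sum>t\<in>{1..T}. b t) = (\<Sum>t\<in>{1..\<tau>}. b t) + (\<Sum>t\<in>{Suc \<tau>..T}. b t)"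
    unfolding split by (rule sum.union_disjoint) auto
  have main: "(\<Sum>t\<in>{1..\<tau>}. r (a t)) + p \<bullet> (\<Sum>t\<in>{1..\<tau>}. g t) - real T * r w \<le> n * (L * bbar)"
  proof -
    have "(\<Sum>t\<in>{1..\<tau>}. r (a t) + p \<bullet> a t) \<le> (\<Sum>t\<in>{1..\<tau>}. r w + p \<bullet> w)"
      using a p(3) \<tau>(1) by (intro sum_mono) auto
    then have 1: "(\<Sum>t\<in>{1..\<tau>}. r (a t)) + p \<bullet> (\<Sum>t\<in>{1..\<tau>}. a t) \<le> real \<tau> * (r w + p \<bullet> w)"
      by (simp add: sum.distrib inner_sum_right)
    \<comment> \<open>As \<open>w\<close> averages all periods, what the first \<tau> periods fall
      short of it is made up afterwards; only \<open>n\<close> terms, each at most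
      \<open>L * bbar\<close>, are left.\<close>
    have "p \<bullet> (real \<tau> *\<^sub>R w - (\<Sum>t\<in>{1..\<tau>}. b t)) = p \<bullet> (\<Sum>t\<in>{Suc \<tau>..T}. b t - w)"
    proof -
      have "(\<Sum>t\<in>{Suc \<tau>..T}. b t - w) = (\<Sum>t\<in>{Suc \<tau>..T}. b t) - n *\<^sub>R w"
        by (simp add: sum_subtractf n_def sum_constant_scaleR del: sum_constant)
      also have "\<dots> = real \<tau> *\<^sub>R w - (\<Sum>t\<in>{1..\<tau>}. b t)"
        using sum_split sum_b T_eq by (simp add: algebra_simps)
      finally show ?thesis by simp
    qed
    also have "\<dots> = (\<Sum>t\<in>{Suc \<tau>..T}. p \<bullet> (b t - w))" by (simp add: inner_sum_right)
    also have "\<dots> \<le> (\<Sum>t\<in>{Suc \<tau>..T}. L * bbar)"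
    proof (rule sum_mono)
      fix t assume "t \<in> {Suc \<tau>..T}"
      then have t: "t \<in> {1..T}" by auto
      have "p \<bullet> (b t - w) \<le> l1norm p * infnorm (b t - w)"
        using inner_le_l1norm_infnorm[of p "b t - w"] by linarith
      also have "\<dots> \<le> L * bbar"
        using p(1) L_nonneg infnorm_diff_le[OF b(1)[OF t] w0 b(2)[OF t] w_le]
        by (intro mult_mono) (auto simp: infnorm_pos_le)
      finally show "p \<bullet> (b t - w) \<le> L * bbar" .
    qed
    also have "\<dots> = n * (L * bbar)" by (simp add: n_def)
    finally have 2: "p \<bullet> (real \<tau> *\<^sub>R w - (\<Sum>t\<in>{1..\<tau>}. b t)) \<le> n * (L * bbar)" .
    \<comment> \<open>Concavity yields \<tau> copies of \<open>r w\<close> while T copies are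
      subtracted; nonnegativity of \<open>r w\<close> settles the difference.\<close>
    have "0 \<le> n * r w" using r_w T_eq by simp
    with 1 2 show ?thesis
      by (simp add: g_def sum_subtractf inner_diff_right T_eq algebra_simps)
  qed
  have md: "(\<Sum>t\<in>{1..\<tau>}. g t \<bullet> dual_seq g t)
      \<le> \<nu> \<bullet> (\<Sum>t\<in>{1..\<tau>}. g t) + drift * \<eta> * real T + c / \<eta>"
    if \<nu>: "\<nu> \<in> D" "l1norm \<nu> \<le> L + K" for \<nu>
  proof -
    have "(\<Sum>t\<in>{1..\<tau>}. g t \<bullet> dual_seq g t) = \<nu> \<bullet> (\<Sum>t\<in>{1..\<tau>}. g t) + (\<Sum>t\<in>{1..\<tau>}. g t \<bullet> (dual_seq g t - \<nu>))"
      by (simp add: inner_diff_right sum_subtractf inner_sum_right inner_commute)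
    moreover have "real \<tau> * (\<eta> * drift) \<le> real T * (\<eta> * drift)"
      using \<tau>(1) eta_pos drift_nonneg by (intro mult_right_mono) auto
    moreover have "V \<nu> \<mu>0 / \<eta> \<le> c / \<eta>" using c[OF \<nu>] eta_pos by (simp add: divide_right_mono)
    ultimately show ?thesis
      using dual_path_regret[OF path g \<nu>(1) \<tau>(1)] by (simp add: mult_ac)
  qed
  have KC: "0 \<le> bbar * K" using bounds_nonneg K_nonneg by simp
  show ?thesis
  proof (cases "\<tau> = T")
    case True
    then have "n = 0" by (simp add: n_def)
    then show ?thesis
      using main md[OF p(2)] p(1) K_nonneg KC True unfolding w_def[symmetric]
      by (simp add: sum.distrib)
  next
    case False
    then have "\<tau> < T" using \<tau>(1) by simp
    then obtain j where j: "real T * \<rho> $ j < (\<Sum>t\<in>{1..<Suc \<tau>}. b t $ j) + bbar"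
      using \<tau>(2) by (auto simp: active_def not_le)
    define \<nu> where "\<nu> = p + axis j K"
    have "0 \<le> axis j K" using K_nonneg by (simp add: less_eq_vec_def axis_def)
    then have \<nu>: "\<nu> \<in> D" unfolding \<nu>_def by (rule add_nonneg[OF p(2)])
    have l1: "l1norm \<nu> \<le> L + K"
      using l1norm_triangle[of p "axis j K"] p(1) K_nonneg by (simp add: \<nu>_def l1norm_axis)
    have "(\<Sum>t\<in>{1..\<tau>}. a t $ j) \<le> (\<Sum>t\<in>{1..\<tau>}. \<rho> $ j)"
      using a \<tau>(1) by (intro sum_mono) (auto simp: less_eq_vec_def)
    \<comment> \<open>Consumption of \<open>j\<close> up to \<tau> is within \<open>bbar\<close> of
      the budget while \<open>a t $ j\<close> is at most \<open>\<rho> $ j\<close>. The leftover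
      \<open>K * bbar\<close> becomes \<open>C1\<close>.\<close>
    then have "(\<Sum>t\<in>{1..\<tau>}. g t $ j) \<le> bbar - n * \<rho> $ j"
      using j T_eq by (simp add: g_def sum_subtractf atLeastLessThanSuc_atLeastAtMost algebra_simps)
    then have "K * (\<Sum>t\<in>{1..\<tau>}. g t $ j) \<le> K * (bbar - n * \<rho> $ j)"
      using K_nonneg by (rule mult_left_mono)
    moreover have "n * (fbar + rbar + L * (bbar + abar)) \<le> n * (K * \<rho> $ j)"
      using K_rho T_eq by (intro mult_left_mono) auto
    moreover have "0 \<le> n * (L * abar)" using T_eq L_nonneg abar_nonneg by simp
    moreover have "\<nu> \<bullet> (\<Sum>t\<in>{1..\<tau>}. g t) = p \<bullet> (\<Sum>t\<in>{1..\<tau>}. g t) + K * (\<Sum>t\<in>{1..\<tau>}. g t $ j)"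
      by (simp add: \<nu>_def inner_add_left inner_axis' )
    ultimately show ?thesis
      using main md[OF \<nu> l1] unfolding w_def[symmetric] n_def[symmetric]
      by (simp add: sum.distrib algebra_simps)
  qed
qed

end

section \<open>Runs of the algorithm, the offline optimum and weak duality\<close>

context allocation
begin

lemma reg_argmaxD:
  assumes "v \<in> reg_argmax \<rho> r \<mu>"
  shows "v \<le> \<rho>" "\<And>w. w \<le> \<rho> \<Longrightarrow> r w + \<mu> \<bullet> w \<le> r v + \<mu> \<bullet> v"
  using assms by (auto simp: reg_argmax_def is_arg_max_def not_less)

text \<open>Ties in the choice of \<open>a\<close> may be broken by the current request; for a fixed
  dual variable the conjugate value is a constant nevertheless.\<close>

lemma reg_argmax_value:
  assumes "v \<in> reg_argmax \<rho> r \<mu>" "w \<in> reg_argmax \<rho> r \<mu>"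
  shows "r v + \<mu> \<bullet> v = r w + \<mu> \<bullet> w"
  using reg_argmaxD[OF assms(1)] reg_argmaxD[OF assms(2)] by (intro antisym) auto

text \<open>Eliminates the existentially quantified iterates in favour of \<open>dual_seq\<close>, a
  function of the subgradients alone, whose dependence on the past and measurability can then be
  studied.\<close>

lemma dmd_runD:
  fixes \<gamma> :: "nat \<Rightarrow> ('d::finite, 'm) request"
  defines "b x t \<equiv> consumption (\<gamma> t) (x t :: real ^ 'd)"
  defines "g x a t \<equiv> a t - b x t"
  assumes run: "dmd_run T \<rho> r abar h \<eta> \<mu>0 \<gamma> x a"
    and valid: "\<And>t. t \<in> {1..T} \<Longrightarrow> valid_request fbar bbar (\<gamma> t)"
  shows "dual_path (g x a)"
    and "\<And>t. t \<in> {1..T} \<Longrightarrow> a t \<in> reg_argmax \<rho> r (dual_seq (g x a) t)"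
    and "\<And>t. t \<in> {1..T} \<Longrightarrow> infnorm (a t) \<le> abar"
    and "\<And>t. t \<in> {1..T} \<Longrightarrow> x t \<in> decisions (\<gamma> t)"
    and "(\<Sum>t\<in>{1..T}. b x t) \<le> real T *\<^sub>R \<rho>"
    and "\<And>t y. t \<in> {1..T} \<Longrightarrow> active T bbar \<rho> (b x) t \<Longrightarrow> y \<in> decisions (\<gamma> t) \<Longrightarrow>
      reward (\<gamma> t) y - dual_seq (g x a) t \<bullet> consumption (\<gamma> t) y
      \<le> reward (\<gamma> t) (x t) - dual_seq (g x a) t \<bullet> b x t"
proof -
  let ?b = "b x" and ?g = "g x a"
  obtain \<mu> B xt where run': "\<mu> 1 = \<mu>0 \<and> B 1 = real T *\<^sub>R \<rho> \<and> (\<forall>t\<in>{1..T}.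
          is_arg_max (\<lambda>y. reward (\<gamma> t) y - \<mu> t \<bullet> consumption (\<gamma> t) y) (\<lambda>y. y \<in> decisions (\<gamma> t)) (xt t) \<and>
          x t = (if consumption (\<gamma> t) (xt t) \<le> B t then xt t else 0) \<and>
          B (Suc t) = B t - ?b t \<and>
          a t \<in> reg_argmax \<rho> r (\<mu> t) \<and> infnorm (a t) \<le> abar \<and>
          is_arg_min (\<lambda>\<nu>. (- ?b t + a t) \<bullet> \<nu> + 1 / \<eta> * V \<nu> (\<mu> t)) (\<lambda>\<nu>. \<nu> \<in> D) (\<mu> (Suc t)))"
    using run unfolding dmd_run_def b_def by (elim exE)
  then have init': "\<mu> 1 = \<mu>0" "B 1 = real T *\<^sub>R \<rho>" by simp_all
  note step = run'[THEN conjunct2, THEN conjunct2, rule_format]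
  have mirror: "is_mirror (grad D h (\<mu> t) - \<eta> *\<^sub>R ?g t) (\<mu> (Suc t))" if "t \<in> {1..T}" for t
  proof (rule is_mirror_step[OF eta_pos])
    have "?g t = - ?b t + a t" by (simp add: g_def)
    then show "is_arg_min (\<lambda>\<nu>. ?g t \<bullet> \<nu> + 1 / \<eta> * V \<nu> (\<mu> t)) (\<lambda>\<nu>. \<nu> \<in> D) (\<mu> (Suc t))"
      using step[OF that] by simp
  qed
  have \<mu>_Suc: "\<mu> (Suc s) = dual_seq ?g (Suc s)" if "s \<le> T" for s
    using that
  proof (induction s)
    case 0
    then show ?case using init' by simp
  next
    case (Suc s)
    then show ?case
      using mirror[of "Suc s"] by (intro dual_seq_SucI[symmetric]) auto
  qed
  have \<mu>: "\<mu> t = dual_seq ?g t" if "t \<in> {1..Suc T}" for t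
    using that \<mu>_Suc[of "t - 1"] by auto
  show "dual_path ?g"
    using mirror \<mu> by (simp add: dual_path_def)
  show "a t \<in> reg_argmax \<rho> r (dual_seq ?g t)" "infnorm (a t) \<le> abar" if "t \<in> {1..T}" for t
    using step[OF that] \<mu>[of t] that by auto
  have xt: "xt t \<in> decisions (\<gamma> t)" if "t \<in> {1..T}" for t
    using step[OF that] by (simp add: is_arg_max_def)
  show x: "x t \<in> decisions (\<gamma> t)" if "t \<in> {1..T}" for t
    using step[OF that] valid[OF that] xt[OF that] by (auto simp: valid_request_def)
  \<comment> \<open>Both claims are proved together: the default action 0 is affordable only while
    the remaining budget is nonnegative.\<close>
  have B: "B (Suc s) = real T *\<^sub>R \<rho> - (\<Sum>u\<in>{1..s}. ?b u) \<and> (\<Sum>u\<in>{1..s}. ?b u) \<le> real T *\<^sub>R \<rho>" if "s \<le> T" for s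
    using that
  proof (induction s)
    case 0
    then show ?case using init' rho_nonneg by (simp add: nonneg_scaleR_vec)
  next
    case (Suc s)
    then have t: "Suc s \<in> {1..T}" by simp
    have "consumption (\<gamma> (Suc s)) 0 = 0" using valid[OF t] by (simp add: valid_request_def)
    then have "?b (Suc s) \<le> B (Suc s)" using step[OF t] Suc by (auto simp: b_def)
    moreover have "B (Suc (Suc s)) = B (Suc s) - ?b (Suc s)" using step[OF t] by blast
    moreover have "B (Suc s) = real T *\<^sub>R \<rho> - (\<Sum>u\<in>{1..s}. ?b u)" using Suc by simp
    ultimately show ?case by (simp add: diff_diff_eq le_diff_eq add.commute)
  qed
  show "(\<Sum>t\<in>{1..T}. ?b t) \<le> real T *\<^sub>R \<rho>" using B[of T] by simp
  fix t y assume t: "t \<in> {1..T}" and act: "active T bbar \<rho> ?b t" and y: "y \<in> decisions (\<gamma> t)"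
  \<comment> \<open>While \<open>active\<close> holds, at least \<open>bbar\<close> of every
    resource remains, so the tentative maximizer is played.\<close>
  have "consumption (\<gamma> t) (xt t) \<le> B t"
  proof -
    have "B t = real T *\<^sub>R \<rho> - (\<Sum>u\<in>{1..<t}. ?b u)"
      using B[of "t - 1"] t by (cases t) (auto simp: atLeastLessThanSuc_atLeastAtMost)
    moreover have "consumption (\<gamma> t) (xt t) $ j \<le> bbar" for j
      using valid[OF t] xt[OF t] component_le_infnorm_cart[of "consumption (\<gamma> t) (xt t)" j]
      by (force simp: valid_request_def)
    ultimately show ?thesis
      using act by (auto simp: less_eq_vec_def active_def le_diff_eq) (smt (verit))
  qed
  then have "x t = xt t" using step[OF t] by simp
  then show "reward (\<gamma> t) y - dual_seq ?g t \<bullet> consumption (\<gamma> t) y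
      \<le> reward (\<gamma> t) (x t) - dual_seq ?g t \<bullet> ?b t"
    using step[OF t] \<mu>[of t] t y by (auto simp: is_arg_max_def not_less b_def)
qed

lemma total_reward_bounds:
  assumes valid: "\<And>t. t \<in> {1..T} \<Longrightarrow> valid_request fbar bbar (\<gamma> t)" and x: "x \<in> feasible T \<rho> \<gamma>"
  shows "0 \<le> total_reward T r \<gamma> x" "total_reward T r \<gamma> x \<le> real T * (fbar + rbar)"
proof -
  let ?w = "(1 / real T) *\<^sub>R (\<Sum>t\<in>{1..T}. consumption (\<gamma> t) (x t))"
  have b: "0 \<le> consumption (\<gamma> t) (x t)" and f: "0 \<le> reward (\<gamma> t) (x t)" "reward (\<gamma> t) (x t) \<le> fbar"
    if "t \<in> {1..T}" for t
    using valid[OF that] x that by (auto simp: valid_request_def feasible_def)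
  have "0 \<le> ?w" using b by (intro nonneg_scaleR_vec sum_nonneg) auto
  moreover have "?w \<le> \<rho>"
    using x T by (auto simp: feasible_def less_eq_vec_def field_simps)
  ultimately have r: "0 \<le> real T * r ?w" "real T * r ?w \<le> real T * rbar"
    using r_bounded by (auto intro: mult_left_mono)
  have "0 \<le> (\<Sum>t\<in>{1..T}. reward (\<gamma> t) (x t))" using f by (intro sum_nonneg) auto
  moreover have "(\<Sum>t\<in>{1..T}. reward (\<gamma> t) (x t)) \<le> real T * fbar"
    using sum_bounded_above[of "{1..T}" "\<lambda>t. reward (\<gamma> t) (x t)" fbar] f by simp
  ultimately show "0 \<le> total_reward T r \<gamma> x" "total_reward T r \<gamma> x \<le> real T * (fbar + rbar)"
    using r by (auto simp: total_reward_def distrib_left)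
qed

lemma zero_feasible:
  assumes "\<And>t. t \<in> {1..T} \<Longrightarrow> valid_request fbar bbar (\<gamma> t)"
  shows "(\<lambda>_. 0) \<in> feasible T \<rho> \<gamma>"
proof -
  have "(\<Sum>t\<in>{1..T}. consumption (\<gamma> t) 0) = 0"
    using assms by (intro sum.neutral) (simp add: valid_request_def)
  then show ?thesis
    using assms rho_nonneg by (auto simp: feasible_def valid_request_def nonneg_scaleR_vec)
qed

lemma OPT_leI:
  assumes "\<And>t. t \<in> {1..T} \<Longrightarrow> valid_request fbar bbar (\<gamma> t)"
    and "\<And>x. x \<in> feasible T \<rho> \<gamma> \<Longrightarrow> total_reward T r \<gamma> x \<le> c"
  shows "OPT T \<rho> r \<gamma> \<le> c"
  unfolding OPT_def using zero_feasible[of \<gamma>, OF assms(1)] assms(2) by (intro cSUP_least) auto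

lemma OPT_bounds:
  assumes valid: "\<And>t. t \<in> {1..T} \<Longrightarrow> valid_request fbar bbar (\<gamma> t)"
  shows "0 \<le> OPT T \<rho> r \<gamma>" "OPT T \<rho> r \<gamma> \<le> real T * (fbar + rbar)"
proof -
  have "bdd_above (total_reward T r \<gamma> ` feasible T \<rho> \<gamma>)"
    using total_reward_bounds(2)[of \<gamma>, OF valid] by (intro bdd_aboveI2) auto
  then have "total_reward T r \<gamma> (\<lambda>_. 0) \<le> OPT T \<rho> r \<gamma>"
    unfolding OPT_def using zero_feasible[of \<gamma>, OF valid] by (intro cSUP_upper) auto
  then show "0 \<le> OPT T \<rho> r \<gamma>"
    using total_reward_bounds(1)[of \<gamma>, OF valid zero_feasible[of \<gamma>, OF valid]] by linarith
qed (rule OPT_leI[of \<gamma>, OF valid total_reward_bounds(2)[of \<gamma>, OF valid]])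

text \<open>Weak duality at \<open>\<mu>\<close>; \<open>c\<close> stands for the value of \<open>r\<^sup>*(-\<mu>)\<close>.\<close>

lemma OPT_le_dual:
  assumes valid: "\<And>t. t \<in> {1..T} \<Longrightarrow> valid_request fbar bbar (\<gamma> t)"
    and c: "\<And>w. w \<le> \<rho> \<Longrightarrow> r w + \<mu> \<bullet> w \<le> c"
    and W: "\<And>t y. t \<in> {1..T} \<Longrightarrow> y \<in> decisions (\<gamma> t) \<Longrightarrow>
      reward (\<gamma> t) y - \<mu> \<bullet> consumption (\<gamma> t) y + c \<le> W t"
  shows "OPT T \<rho> r \<gamma> \<le> (\<Sum>t\<in>{1..T}. W t)"
proof (rule OPT_leI[of \<gamma>, OF valid])
  fix x assume x: "x \<in> feasible T \<rho> \<gamma>"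
  let ?w = "(1 / real T) *\<^sub>R (\<Sum>t\<in>{1..T}. consumption (\<gamma> t) (x t))"
  have "?w \<le> \<rho>" using x T by (auto simp: feasible_def less_eq_vec_def field_simps)
  then have "real T * r ?w \<le> real T * (c - \<mu> \<bullet> ?w)"
    using c[of ?w] by (intro mult_left_mono) auto
  also have "\<dots> = (\<Sum>t\<in>{1..T}. c - \<mu> \<bullet> consumption (\<gamma> t) (x t))"
    using T by (simp add: sum_subtractf inner_sum_right right_diff_distrib)
  finally have "total_reward T r \<gamma> x
      \<le> (\<Sum>t\<in>{1..T}. reward (\<gamma> t) (x t) - \<mu> \<bullet> consumption (\<gamma> t) (x t) + c)"
    unfolding total_reward_def by (simp add: sum.distrib sum_subtractf)
  also have "\<dots> \<le> (\<Sum>t\<in>{1..T}. W t)"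
    using x W by (intro sum_mono) (auto simp: feasible_def)
  finally show "total_reward T r \<gamma> x \<le> (\<Sum>t\<in>{1..T}. W t)" .
qed

text \<open>Lipschitz continuity holds on the closed set \<open>{..\<rho>}\<close> only, hence the
  cut-off by its indicator.\<close>

lemma r_comp_measurable:
  assumes f: "f \<in> borel_measurable N" and le: "\<And>\<omega>. \<omega> \<in> space N \<Longrightarrow> f \<omega> \<le> \<rho>"
  shows "(\<lambda>\<omega>. r (f \<omega>)) \<in> borel_measurable N"
proof -
  have "L-lipschitz_on {..\<rho>} r"
  proof (rule lipschitz_onI[OF _ L_nonneg])
    fix u v assume uv: "u \<in> {..\<rho>}" "v \<in> {..\<rho>}"
    have "\<bar>r u - r v\<bar> \<le> L * infnorm (u - v)" using r_lipschitz uv by simp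
    also have "\<dots> \<le> L * norm (u - v)" using L_nonneg infnorm_le_norm by (intro mult_left_mono)
    finally show "dist (r u) (r v) \<le> L * dist u v" by (simp add: dist_norm)
  qed
  moreover have "closed {..\<rho>}"
  proof -
    have "{..\<rho>} = (\<Inter>j. {v. v $ j \<le> \<rho> $ j})" by (auto simp: less_eq_vec_def)
    then show ?thesis by (simp add: closed_INT closed_halfspace_component_le_cart)
  qed
  ultimately have "(\<lambda>x. indicator {..\<rho>} x *\<^sub>R r x) \<in> borel_measurable borel"
    by (intro borel_measurable_continuous_on_indicator) (auto intro: lipschitz_on_continuous_on)
  from measurable_compose[OF f this]
  show ?thesis by (rule measurable_cong[THEN iffD1, rotated]) (simp add: le)
qed

end

subsection \<open>Expected regret\<close>

locale allocation_run = allocation T \<rho> r h fbar bbar abar rbar L \<sigma> \<eta> \<mu>0 + prob_space P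
  for T :: nat and \<rho> :: "real ^ 'm::finite" and r h :: "real ^ 'm \<Rightarrow> real"
    and fbar bbar abar rbar L \<sigma> \<eta> :: real and \<mu>0 :: "real ^ 'm"
    and P :: "('d::finite, 'm) request measure" +
  fixes A :: "('d, 'm, real ^ 'd) online_rule" and a :: "('d, 'm, real ^ 'm) online_rule"
  assumes requests: "\<And>\<gamma>. \<gamma> \<in> space P \<Longrightarrow> valid_request fbar bbar \<gamma>"
    and alg: "dual_mirror_descent (space P) T \<rho> r abar h \<eta> \<mu>0 A a"
    and alg_measurable: "measurable_run P T A a"
    and OPT_measurable: "OPT T \<rho> r \<in> borel_measurable (\<Pi>\<^sub>M t\<in>{1..T}. P)"
begin

definition "\<Omega> = (\<Pi>\<^sub>M t\<in>{1..T}. P)"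

definition "f \<omega> t = reward (\<omega> t) (play A \<omega> t)"
definition "b \<omega> t = consumption (\<omega> t) (play A \<omega> t)"
definition "g \<omega> t = play a \<omega> t - b \<omega> t"

abbreviation "act \<omega> t \<equiv> active T bbar \<rho> (b \<omega>) t"
abbreviation "mu \<omega> t \<equiv> dual_seq (g \<omega>) t"

lemma play_cong:
  assumes "\<And>s. s \<in> {1..t} \<Longrightarrow> \<omega> s = \<omega>' s"
  shows "play R \<omega> t = play R \<omega>' t"
proof -
  have "restrict \<omega> {1..t} = restrict \<omega>' {1..t}" using assms by (auto simp: restrict_def)
  then show ?thesis by (simp add: play_def)
qed

text \<open>The strict inequality on periods is what makes the dual variable a constant when
  coordinate \<open>t\<close> is integrated out.\<close>

lemma past_cong:
  assumes "\<And>s. s \<in> {1..<t} \<Longrightarrow> \<omega> s = \<omega>' s"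
  shows "act \<omega> t = act \<omega>' t" "mu \<omega> t = mu \<omega>' t"
proof -
  have play: "play R \<omega> s = play R \<omega>' s" if "s \<in> {1..<t}" for s and R :: "('d, 'm, 'v) online_rule"
    using that assms by (intro play_cong) auto
  have b: "b \<omega> s = b \<omega>' s" if "s \<in> {1..<t}" for s
    using that assms play[OF that, of A] by (simp add: b_def)
  then show "act \<omega> t = act \<omega>' t" by (rule active_cong)
  have "g \<omega> s = g \<omega>' s" if "s \<in> {1..<t}" for s
    using b[OF that] play[OF that, of a] by (simp add: g_def)
  then show "mu \<omega> t = mu \<omega>' t" by (rule dual_seq_cong)
qed

sublocale \<Omega>: prob_space \<Omega>
  unfolding \<Omega>_def by (intro prob_space_PiM) (rule prob_space_axioms)

lemma space_\<Omega>: "space \<Omega> = {1..T} \<rightarrow>\<^sub>E space P"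
  by (simp add: \<Omega>_def space_PiM)

lemma valid: "\<omega> \<in> space \<Omega> \<Longrightarrow> t \<in> {1..T} \<Longrightarrow> valid_request fbar bbar (\<omega> t)"
  by (intro requests) (auto simp: space_\<Omega>)

lemma run:
  assumes "\<omega> \<in> space \<Omega>"
  shows "dmd_run T \<rho> r abar h \<eta> \<mu>0 \<omega> (play A \<omega>) (play a \<omega>)"
  using alg assms by (simp add: dual_mirror_descent_def space_\<Omega>)

lemma g_eta: "(\<lambda>t. play a \<omega> t - consumption (\<omega> t) (play A \<omega> t)) = g \<omega>"
  by (rule ext) (simp add: g_def b_def)

lemma b_eta: "(\<lambda>t. consumption (\<omega> t) (play A \<omega> t)) = b \<omega>"
  by (rule ext) (simp add: b_def)

lemma run_path: "\<omega> \<in> space \<Omega> \<Longrightarrow> dual_path (g \<omega>)"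
  using dmd_runD(1)[OF run valid] by (simp add: g_eta)

lemma run_argmax: "\<omega> \<in> space \<Omega> \<Longrightarrow> t \<in> {1..T} \<Longrightarrow> play a \<omega> t \<in> reg_argmax \<rho> r (mu \<omega> t)"
  using dmd_runD(2)[OF run valid] by (simp add: g_eta)

lemma run_abar: "\<omega> \<in> space \<Omega> \<Longrightarrow> t \<in> {1..T} \<Longrightarrow> infnorm (play a \<omega> t) \<le> abar"
  using dmd_runD(3)[OF run valid] by simp

lemma run_decisions: "\<omega> \<in> space \<Omega> \<Longrightarrow> t \<in> {1..T} \<Longrightarrow> play A \<omega> t \<in> decisions (\<omega> t)"
  using dmd_runD(4)[OF run valid] by simp

lemma run_budget: "\<omega> \<in> space \<Omega> \<Longrightarrow> (\<Sum>t\<in>{1..T}. b \<omega> t) \<le> real T *\<^sub>R \<rho>"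
  using dmd_runD(5)[OF run valid] by (simp add: b_def)

lemma run_max:
  assumes "\<omega> \<in> space \<Omega>" "t \<in> {1..T}" "act \<omega> t" "y \<in> decisions (\<omega> t)"
  shows "reward (\<omega> t) y - mu \<omega> t \<bullet> consumption (\<omega> t) y \<le> f \<omega> t - mu \<omega> t \<bullet> b \<omega> t"
  using dmd_runD(6)[OF run[OF assms(1)] valid[OF assms(1)], of t y] assms
  by (simp add: g_eta b_eta) (simp add: f_def b_def)

lemma f_bounds: "0 \<le> f \<omega> t" "f \<omega> t \<le> fbar"
  and b_bounds: "0 \<le> b \<omega> t" "infnorm (b \<omega> t) \<le> bbar"
  if "\<omega> \<in> space \<Omega>" "t \<in> {1..T}"
  using valid[OF that] run_decisions[OF that] by (auto simp: valid_request_def f_def b_def)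

lemma a_le_rho: "\<omega> \<in> space \<Omega> \<Longrightarrow> t \<in> {1..T} \<Longrightarrow> play a \<omega> t \<le> \<rho>"
  using reg_argmaxD(1)[OF run_argmax] .

lemma g_bound:
  assumes "\<omega> \<in> space \<Omega>" "t \<in> {1..T}"
  shows "infnorm (g \<omega> t) \<le> bbar + abar"
  using infnorm_triangle[of "play a \<omega> t" "- b \<omega> t"] run_abar[OF assms] b_bounds(2)[OF assms]
  by (simp add: g_def infnorm_neg)

section \<open>Measurability and boundedness of the dual values\<close>

lemma restrict_measurable:
  assumes "t \<in> {1..T}"
  shows "(\<lambda>\<omega>. restrict \<omega> {1..t}) \<in> measurable \<Omega> (\<Pi>\<^sub>M s\<in>{1..t}. P)"
  unfolding \<Omega>_def using assms by (intro measurable_restrict_subset) auto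

lemma run_measurable:
  assumes t: "t \<in> {1..T}"
  shows "(\<lambda>\<omega>. f \<omega> t) \<in> borel_measurable \<Omega>" "(\<lambda>\<omega>. b \<omega> t) \<in> borel_measurable \<Omega>"
    "(\<lambda>\<omega>. play a \<omega> t) \<in> borel_measurable \<Omega>"
proof -
  have "(\<lambda>\<omega>. reward (\<omega> t) (A t \<omega>)) \<in> borel_measurable (\<Pi>\<^sub>M s\<in>{1..t}. P)"
    "(\<lambda>\<omega>. consumption (\<omega> t) (A t \<omega>)) \<in> borel_measurable (\<Pi>\<^sub>M s\<in>{1..t}. P)"
    "a t \<in> borel_measurable (\<Pi>\<^sub>M s\<in>{1..t}. P)"
    using alg_measurable t by (auto simp: measurable_run_def)
  from this[THEN measurable_compose[OF restrict_measurable[OF t]]]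
  show "(\<lambda>\<omega>. f \<omega> t) \<in> borel_measurable \<Omega>" "(\<lambda>\<omega>. b \<omega> t) \<in> borel_measurable \<Omega>"
    "(\<lambda>\<omega>. play a \<omega> t) \<in> borel_measurable \<Omega>"
    using t by (simp_all add: f_def b_def play_def)
qed

lemma g_measurable: "t \<in> {1..T} \<Longrightarrow> (\<lambda>\<omega>. g \<omega> t) \<in> borel_measurable \<Omega>"
  unfolding g_def by (intro borel_measurable_diff run_measurable)

lemma mu_measurable:
  assumes "t \<in> {1..T}"
  shows "(\<lambda>\<omega>. mu \<omega> t) \<in> borel_measurable \<Omega>"
proof -
  have "(\<lambda>\<omega>. mu \<omega> (Suc s)) \<in> borel_measurable \<Omega>" if "s < T" for s
    using that
  proof (induction s)
    case (Suc s)
    then have s: "Suc s \<in> {1..T}" by simp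
    show ?case
    proof (rule measurable_mirror)
      show "(\<lambda>\<omega>. grad D h (mu \<omega> (Suc s)) - \<eta> *\<^sub>R g \<omega> (Suc s)) \<in> borel_measurable \<Omega>"
        using Suc s dual_path_smooth[OF run_path, of _ "Suc s"]
        by (intro borel_measurable_diff borel_measurable_scaleR borel_measurable_const
            measurable_grad_comp g_measurable) auto
      show "is_mirror (grad D h (mu \<omega> (Suc s)) - \<eta> *\<^sub>R g \<omega> (Suc s)) (mu \<omega> (Suc (Suc s)))"
        if "\<omega> \<in> space \<Omega>" for \<omega>
        using run_path[OF that] s by (simp add: dual_path_def)
    qed
  qed simp
  from this[of "t - 1"] show ?thesis using assms by auto
qed

lemma act_measurable: "t \<in> {1..T} \<Longrightarrow> Measurable.pred \<Omega> (\<lambda>\<omega>. act \<omega> t)"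
proof -
  assume t: "t \<in> {1..T}"
  have "(\<lambda>\<omega>. b \<omega> s $ j) \<in> borel_measurable \<Omega>" if "s \<in> {1..<t}" for s j
    using run_measurable(2)[of s] that t by (intro borel_measurable_vec_iff[THEN iffD1, rule_format]) auto
  then have [measurable]: "(\<lambda>\<omega>. \<Sum>s\<in>{1..<t}. b \<omega> s $ j) \<in> borel_measurable \<Omega>" for j
    by (rule borel_measurable_sum)
  show "Measurable.pred \<Omega> (\<lambda>\<omega>. act \<omega> t)"
    unfolding active_def by measurable
qed

text \<open>The active branch is the Lagrangian value
  \<open>f \<omega> t - mu \<omega> t \<bullet> b \<omega> t\<close> plus the conjugate value
  \<open>r (play a \<omega> t) + mu \<omega> t \<bullet> play a \<omega> t\<close>, regrouped
  through \<open>g\<close>.\<close>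

definition "Z \<omega> t =
  (if act \<omega> t then f \<omega> t + r (play a \<omega> t) + g \<omega> t \<bullet> mu \<omega> t else fbar + rbar)"

lemma Z_measurable:
  assumes t: "t \<in> {1..T}"
  shows "(\<lambda>\<omega>. Z \<omega> t) \<in> borel_measurable \<Omega>"
proof -
  have [measurable]: "(\<lambda>\<omega>. r (play a \<omega> t)) \<in> borel_measurable \<Omega>"
    by (rule r_comp_measurable[OF run_measurable(3)[OF t] a_le_rho[OF _ t]])
  note [measurable] = act_measurable[OF t] run_measurable[OF t] g_measurable[OF t] mu_measurable[OF t]
  show ?thesis unfolding Z_def by measurable
qed

lemma Z_bounded:
  obtains N where "\<And>\<omega> t. \<omega> \<in> space \<Omega> \<Longrightarrow> t \<in> {1..T} \<Longrightarrow> \<bar>Z \<omega> t\<bar> \<le> N"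
proof -
  define N where "N = l1norm \<mu>0 + real T * (\<eta> * (bbar + abar) / \<sigma>)"
  have "\<bar>Z \<omega> t\<bar> \<le> fbar + (rbar + L * abar) + N * (bbar + abar)" if \<omega>: "\<omega> \<in> space \<Omega>" and t: "t \<in> {1..T}" for \<omega> t
  proof -
    have mu: "l1norm (mu \<omega> t) \<le> N"
      unfolding N_def by (rule dual_path_bounded[OF run_path[OF \<omega>] g_bound[OF \<omega>] t])
    \<comment> \<open>The vector \<open>a\<close> may have negative coordinates, where
      \<open>r_bounded\<close> is silent, so \<open>r\<close> is controlled by its distance from
      \<open>r 0\<close>.\<close>
    have "\<bar>r (play a \<omega> t) - r 0\<bar> \<le> L * infnorm (play a \<omega> t - 0)"
      by (rule r_lipschitz[OF a_le_rho[OF \<omega> t] rho_nonneg])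
    also have "\<dots> \<le> L * abar" using run_abar[OF \<omega> t] L_nonneg by (simp add: mult_left_mono)
    finally have r: "\<bar>r (play a \<omega> t)\<bar> \<le> rbar + L * abar"
      using r_bounded[of 0] rho_nonneg by auto
    have "\<bar>g \<omega> t \<bullet> mu \<omega> t\<bar> \<le> l1norm (mu \<omega> t) * infnorm (g \<omega> t)"
      using inner_le_l1norm_infnorm[of "mu \<omega> t" "g \<omega> t"] by (simp add: inner_commute)
    also have "\<dots> \<le> N * (bbar + abar)"
      using mu g_bound[OF \<omega> t] order_trans[OF l1norm_nonneg mu]
      by (intro mult_mono) (auto simp: infnorm_pos_le)
    finally have gm: "\<bar>g \<omega> t \<bullet> mu \<omega> t\<bar> \<le> N * (bbar + abar)" .
    moreover have "0 \<le> L * abar" using L_nonneg abar_nonneg by simp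
    ultimately show ?thesis
      using r f_bounds[OF \<omega> t] bounds_nonneg rbar_nonneg by (auto simp: Z_def abs_le_iff)
  qed
  then show ?thesis by (rule that)
qed

lemma OPT_run_bounds:
  assumes "\<omega> \<in> space \<Omega>"
  shows "0 \<le> OPT T \<rho> r \<omega>" "OPT T \<rho> r \<omega> \<le> real T * (fbar + rbar)"
  using OPT_bounds[of \<omega>, OF valid[OF assms]] by auto

lemma OPT_integrable: "integrable \<Omega> (OPT T \<rho> r)"
proof (rule \<Omega>.integrable_const_bound[where B = "real T * (fbar + rbar)"])
  show "AE \<omega> in \<Omega>. norm (OPT T \<rho> r \<omega>) \<le> real T * (fbar + rbar)"
    using OPT_run_bounds by (intro AE_I2) simp
qed (use OPT_measurable in \<open>simp add: \<Omega>_def\<close>)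

lemma integral_OPT_le: "(\<integral>\<omega>. OPT T \<rho> r \<omega> \<partial>\<Omega>) \<le> real T * (fbar + rbar)"
  using OPT_integrable OPT_run_bounds(2) by (intro \<Omega>.integral_le_const) auto

lemma integral_component:
  fixes W :: "('d, 'm) request \<Rightarrow> real"
  assumes "W \<in> borel_measurable P" "s \<in> {1..T}"
  shows "(\<integral>\<omega>. W (\<omega> s) \<partial>\<Omega>) = (\<integral>y. W y \<partial>P)"
proof -
  have "distr \<Omega> P (\<lambda>\<omega>. \<omega> s) = P"
    unfolding \<Omega>_def using assms(2) by (intro distr_PiM_component) (rule prob_space_axioms)
  then have "(\<integral>y. W y \<partial>P) = (\<integral>y. W y \<partial>distr \<Omega> P (\<lambda>\<omega>. \<omega> s))" by simp
  also have "\<dots> = (\<integral>\<omega>. W (\<omega> s) \<partial>\<Omega>)"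
    using assms by (intro integral_distr) (auto simp: \<Omega>_def)
  finally show ?thesis ..
qed

text \<open>
  Conditionally on the other requests, the dual variable of period \<open>t\<close> is a constant, and every
  fixed dual variable gives an upper bound on the optimum through \<open>OPT_le_dual\<close>.
\<close>

lemma conditional_bound:
  assumes t: "t \<in> {1..T}" and x: "x \<in> space (\<Pi>\<^sub>M s\<in>{1..T} - {t}. P)"
  shows "(\<integral>\<omega>. OPT T \<rho> r \<omega> \<partial>\<Omega>) \<le> real T * (\<integral>y. Z (x(t := y)) t \<partial>P)"
proof -
  have ins: "insert t ({1..T} - {t}) = {1..T}" using t by auto
  have upd_meas: "(\<lambda>y. x(t := y)) \<in> measurable P \<Omega>"
    using measurable_component_update[OF x, of t] unfolding ins \<Omega>_def by simp
  then have upd: "x(t := y) \<in> space \<Omega>" if "y \<in> space P" for y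
    using that by (auto dest: measurable_space)
  define W where "W y = Z (x(t := y)) t" for y
  have W_meas: "W \<in> borel_measurable P"
    unfolding W_def by (rule measurable_compose[OF upd_meas Z_measurable[OF t]])
  obtain N where N: "\<And>\<omega> t. \<omega> \<in> space \<Omega> \<Longrightarrow> t \<in> {1..T} \<Longrightarrow> \<bar>Z \<omega> t\<bar> \<le> N"
    using Z_bounded by blast
  \<comment> \<open>An arbitrary reference request, used to name the dual variable that all
    \<open>x(t := y)\<close> share.\<close>
  obtain y0 where y0: "y0 \<in> space P" using not_empty by blast
  define m where "m = mu (x(t := y0)) t"
  have mu_eq: "mu (x(t := y)) t = m" and act_eq: "act (x(t := y)) t = act (x(t := y0)) t" for y
    unfolding m_def by (rule past_cong; simp)+
  show ?thesis
  proof (cases "act (x(t := y0)) t")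
    case False
    then have "W y = fbar + rbar" for y using act_eq by (simp add: W_def Z_def)
    then have "(\<integral>y. W y \<partial>P) = fbar + rbar" by (simp add: prob_space)
    then show ?thesis using integral_OPT_le by (simp add: W_def)
  next
    case True
    define v where "v = play a (x(t := y0)) t"
    have v: "v \<in> reg_argmax \<rho> r m"
      unfolding v_def m_def by (rule run_argmax[OF upd[OF y0] t])
    have W_ge: "reward y z - m \<bullet> consumption y z + (r v + m \<bullet> v) \<le> W y"
      if y: "y \<in> space P" and z: "z \<in> decisions y" for y z
    proof -
      let ?\<omega> = "x(t := y)"
      have act: "act ?\<omega> t" using True act_eq by blast
      have "reward y z - m \<bullet> consumption y z \<le> f ?\<omega> t - m \<bullet> b ?\<omega> t"
        using run_max[OF upd[OF y] t act, of z] z by (simp add: mu_eq)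
      moreover have "r (play a ?\<omega> t) + m \<bullet> play a ?\<omega> t = r v + m \<bullet> v"
        using run_argmax[OF upd[OF y] t] v by (intro reg_argmax_value) (simp_all add: mu_eq)
      moreover have "g ?\<omega> t \<bullet> m = m \<bullet> play a ?\<omega> t - m \<bullet> b ?\<omega> t"
        by (simp add: g_def inner_commute[of _ m] inner_diff_right)
      ultimately show ?thesis using act by (simp add: W_def Z_def mu_eq)
    qed
    have W_int: "integrable \<Omega> (\<lambda>\<omega>. W (\<omega> s))" if s: "s \<in> {1..T}" for s
    proof (rule \<Omega>.integrable_const_bound[where B = N])
      show "AE \<omega> in \<Omega>. norm (W (\<omega> s)) \<le> N"
      proof (rule AE_I2)
        fix \<omega> assume "\<omega> \<in> space \<Omega>"
        then have "\<omega> s \<in> space P" using s by (simp add: space_\<Omega> PiE_iff)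
        then show "norm (W (\<omega> s)) \<le> N" using N[OF upd t] by (simp add: W_def)
      qed
      show "(\<lambda>\<omega>. W (\<omega> s)) \<in> borel_measurable \<Omega>"
        unfolding \<Omega>_def by (rule measurable_compose[OF measurable_component_singleton[OF s] W_meas])
    qed
    have "(\<integral>\<omega>. OPT T \<rho> r \<omega> \<partial>\<Omega>) \<le> (\<integral>\<omega>. (\<Sum>s\<in>{1..T}. W (\<omega> s)) \<partial>\<Omega>)"
    proof (rule integral_mono[OF OPT_integrable])
      show "integrable \<Omega> (\<lambda>\<omega>. \<Sum>s\<in>{1..T}. W (\<omega> s))" using W_int by (rule Bochner_Integration.integrable_sum)
      show "OPT T \<rho> r \<omega> \<le> (\<Sum>s\<in>{1..T}. W (\<omega> s))" if "\<omega> \<in> space \<Omega>" for \<omega>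
        using that W_ge by (intro OPT_le_dual[OF valid[OF that] reg_argmaxD(2)[OF v]]) (auto simp: space_\<Omega> PiE_iff)
    qed
    also have "\<dots> = (\<Sum>s\<in>{1..T}. \<integral>\<omega>. W (\<omega> s) \<partial>\<Omega>)"
      using W_int by (rule Bochner_Integration.integral_sum)
    also have "\<dots> = real T * (\<integral>y. W y \<partial>P)"
      using integral_component[OF W_meas] by simp
    finally show ?thesis by (simp add: W_def)
  qed
qed

lemma Z_integrable: "t \<in> {1..T} \<Longrightarrow> integrable \<Omega> (\<lambda>\<omega>. Z \<omega> t)"
proof -
  assume t: "t \<in> {1..T}"
  obtain N where N: "\<And>\<omega> t. \<omega> \<in> space \<Omega> \<Longrightarrow> t \<in> {1..T} \<Longrightarrow> \<bar>Z \<omega> t\<bar> \<le> N"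
    using Z_bounded by blast
  then show ?thesis
    using Z_measurable t by (intro \<Omega>.integrable_const_bound[where B = N]) auto
qed

text \<open>By Fubini coordinate \<open>t\<close> is integrated first;
  \<open>conditional_bound\<close> holds for every choice of the other requests, hence on
  average.\<close>

lemma expected_Z:
  assumes t: "t \<in> {1..T}"
  shows "(\<integral>\<omega>. OPT T \<rho> r \<omega> \<partial>\<Omega>) \<le> real T * (\<integral>\<omega>. Z \<omega> t \<partial>\<Omega>)"
proof -
  let ?I = "{1..T} - {t}"
  let ?X = "\<Pi>\<^sub>M s\<in>?I. P"
  have ins: "insert t ?I = {1..T}" using t by auto
  interpret product_sigma_finite "\<lambda>_. P" by unfold_locales
  interpret X: prob_space ?X by (intro prob_space_PiM) (rule prob_space_axioms)
  obtain N where N: "\<And>\<omega> t. \<omega> \<in> space \<Omega> \<Longrightarrow> t \<in> {1..T} \<Longrightarrow> \<bar>Z \<omega> t\<bar> \<le> N"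
    using Z_bounded by blast
  have eq: "(\<integral>\<omega>. Z \<omega> t \<partial>\<Omega>) = (\<integral>x. (\<integral>y. Z (x(t := y)) t \<partial>P) \<partial>?X)"
    using product_integral_insert[of ?I t "\<lambda>\<omega>. Z \<omega> t"] Z_integrable[OF t]
    unfolding ins \<Omega>_def by simp
  have "(\<lambda>(x, y). x(t := y)) \<in> measurable (?X \<Otimes>\<^sub>M P) \<Omega>"
    using measurable_add_dim[of t ?I "\<lambda>_. P"] unfolding ins \<Omega>_def by simp
  from measurable_compose[OF this Z_measurable[OF t]]
  have meas: "(\<lambda>(x, y). Z (x(t := y)) t) \<in> borel_measurable (?X \<Otimes>\<^sub>M P)"
    by (simp add: case_prod_unfold)
  have bound: "\<bar>\<integral>y. Z (x(t := y)) t \<partial>P\<bar> \<le> N" if x: "x \<in> space ?X" for x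
  proof -
    have upd_meas: "(\<lambda>y. x(t := y)) \<in> measurable P \<Omega>"
      using measurable_component_update[OF x, of t] unfolding ins \<Omega>_def by simp
    then have b: "\<bar>Z (x(t := y)) t\<bar> \<le> N" if "y \<in> space P" for y
      using that N t by (auto dest: measurable_space)
    then have int: "integrable P (\<lambda>y. Z (x(t := y)) t)"
      using measurable_compose[OF upd_meas Z_measurable[OF t]]
      by (intro integrable_const_bound[where B = N]) auto
    show ?thesis
      unfolding abs_le_iff using b int
      by (auto intro!: integral_le_const integral_ge_const simp: abs_le_iff minus_le_iff)
  qed
  have "integrable ?X (\<lambda>x. \<integral>y. Z (x(t := y)) t \<partial>P)"
    using bound borel_measurable_lebesgue_integral[OF meas]
    by (intro X.integrable_const_bound[where B = N]) auto
  then have "(\<integral>\<omega>. OPT T \<rho> r \<omega> \<partial>\<Omega>) \<le> (\<integral>x. real T * (\<integral>y. Z (x(t := y)) t \<partial>P) \<partial>?X)"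
    using conditional_bound[OF t] by (intro X.integral_ge_const) auto
  then show ?thesis by (simp add: eq)
qed

text \<open>The rewards up to \<tau> cancel against those inside \<open>Z\<close>, which leaves the
  terms estimated in \<open>stopped_regret\<close>.\<close>

lemma pathwise_bound:
  assumes \<omega>: "\<omega> \<in> space \<Omega>"
    and c: "\<And>\<nu>. \<nu> \<in> D \<Longrightarrow> l1norm \<nu> \<le> L + K \<Longrightarrow> V \<nu> \<mu>0 \<le> c"
  shows "(\<Sum>t\<in>{1..T}. Z \<omega> t) - total_reward T r \<omega> (play A \<omega>)
    \<le> bbar * K + drift * \<eta> * real T + c / \<eta>"
proof -
  have anti: "act \<omega> s" if "act \<omega> t" "s \<le> t" "t \<le> T" for s t
    using that b_bounds(1)[OF \<omega>] by (intro active_antimono[OF that(1,2)]) auto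
  \<comment> \<open>Consumptions are known to be nonnegative only within the horizon, so the
    monotone predicate includes \<open>t \<le> T\<close>.\<close>
  obtain \<tau> where \<tau>: "\<tau> \<le> T" "\<And>t. t \<in> {1..T} \<Longrightarrow> act \<omega> t \<and> t \<le> T \<longleftrightarrow> t \<le> \<tau>"
    "\<tau> < T \<Longrightarrow> \<not> (act \<omega> (Suc \<tau>) \<and> Suc \<tau> \<le> T)"
    by (rule initial_segment[of "\<lambda>t. act \<omega> t \<and> t \<le> T" T])
       (auto intro: anti)
  have stopped: "(\<Sum>t\<in>{1..\<tau>}. r (play a \<omega> t) + g \<omega> t \<bullet> mu \<omega> t) + real (T - \<tau>) * (fbar + rbar)
      - real T * r ((1 / real T) *\<^sub>R (\<Sum>t\<in>{1..T}. b \<omega> t)) \<le> bbar * K + drift * \<eta> * real T + c / \<eta>"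
    using stopped_regret[of "b \<omega>" "play a \<omega>" c \<tau>, folded g_def, OF b_bounds[OF \<omega>] a_le_rho[OF \<omega>]
        g_bound[OF \<omega>] run_path[OF \<omega>] run_budget[OF \<omega>] c \<tau>(1)] \<tau>(3)
    by auto
  have "{1..T} = {1..\<tau>} \<union> {Suc \<tau>..T}" using \<tau>(1) by auto
  then have split: "(\<Sum>t\<in>{1..T}. u t) = (\<Sum>t\<in>{1..\<tau>}. u t) + (\<Sum>t\<in>{Suc \<tau>..T}. u t)" for u :: "nat \<Rightarrow> real"
    by (simp add: sum.union_disjoint)
  have "(\<Sum>t\<in>{1..\<tau>}. Z \<omega> t) = (\<Sum>t\<in>{1..\<tau>}. f \<omega> t) + (\<Sum>t\<in>{1..\<tau>}. r (play a \<omega> t) + g \<omega> t \<bullet> mu \<omega> t)"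
    unfolding sum.distrib[symmetric] using \<tau>(1,2) by (intro sum.cong) (auto simp: Z_def)
  moreover have "(\<Sum>t\<in>{Suc \<tau>..T}. Z \<omega> t) = (\<Sum>t\<in>{Suc \<tau>..T}. fbar + rbar)"
    using \<tau>(2) by (intro sum.cong) (auto simp: Z_def)
  \<comment> \<open>Rewards collected after stopping are simply given away.\<close>
  moreover have "0 \<le> (\<Sum>t\<in>{Suc \<tau>..T}. f \<omega> t)"
    using f_bounds(1)[OF \<omega>] by (intro sum_nonneg) auto
  ultimately have "(\<Sum>t\<in>{1..T}. Z \<omega> t) - (\<Sum>t\<in>{1..T}. f \<omega> t)
      \<le> (\<Sum>t\<in>{1..\<tau>}. r (play a \<omega> t) + g \<omega> t \<bullet> mu \<omega> t) + real (T - \<tau>) * (fbar + rbar)"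
    unfolding split by simp
  with stopped show ?thesis
    by (simp add: total_reward_def f_def[symmetric] b_def[symmetric])
qed

lemma total_reward_integrable: "integrable \<Omega> (\<lambda>\<omega>. total_reward T r \<omega> (play A \<omega>))"
proof (rule \<Omega>.integrable_const_bound[where B = "real T * (fbar + rbar)"])
  have feas: "play A \<omega> \<in> feasible T \<rho> \<omega>" if "\<omega> \<in> space \<Omega>" for \<omega>
    using run_decisions[OF that] run_budget[OF that] by (simp add: feasible_def b_def)
  show "AE \<omega> in \<Omega>. norm (total_reward T r \<omega> (play A \<omega>)) \<le> real T * (fbar + rbar)"
  proof (rule AE_I2)
    fix \<omega> assume \<omega>: "\<omega> \<in> space \<Omega>"
    show "norm (total_reward T r \<omega> (play A \<omega>)) \<le> real T * (fbar + rbar)"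
      using total_reward_bounds[of \<omega>, OF valid[OF \<omega>] feas[OF \<omega>]] by simp
  qed
  have "(\<lambda>\<omega>. r ((1 / real T) *\<^sub>R (\<Sum>t\<in>{1..T}. b \<omega> t))) \<in> borel_measurable \<Omega>"
  proof (rule r_comp_measurable)
    show "(\<lambda>\<omega>. (1 / real T) *\<^sub>R (\<Sum>t\<in>{1..T}. b \<omega> t)) \<in> borel_measurable \<Omega>"
      by (intro borel_measurable_scaleR borel_measurable_const borel_measurable_sum run_measurable)
    show "(1 / real T) *\<^sub>R (\<Sum>t\<in>{1..T}. b \<omega> t) \<le> \<rho>" if "\<omega> \<in> space \<Omega>" for \<omega>
      using run_budget[OF that] T by (auto simp: less_eq_vec_def field_simps)
  qed
  then show "(\<lambda>\<omega>. total_reward T r \<omega> (play A \<omega>)) \<in> borel_measurable \<Omega>"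
    unfolding total_reward_def f_def[symmetric] b_def[symmetric]
    by (intro borel_measurable_add borel_measurable_times borel_measurable_const borel_measurable_sum
        run_measurable)
qed

lemma expected_regret:
  assumes c: "\<And>\<nu>. \<nu> \<in> D \<Longrightarrow> l1norm \<nu> \<le> L + K \<Longrightarrow> V \<nu> \<mu>0 \<le> c"
  shows "(\<integral>\<omega>. OPT T \<rho> r \<omega> - total_reward T r \<omega> (play A \<omega>) \<partial>\<Omega>)
    \<le> bbar * K + drift * \<eta> * real T + c / \<eta>"
proof -
  let ?R = "\<lambda>\<omega>. total_reward T r \<omega> (play A \<omega>)"
  have Z_int: "integrable \<Omega> (\<lambda>\<omega>. \<Sum>t\<in>{1..T}. Z \<omega> t)"
    using Z_integrable by (rule Bochner_Integration.integrable_sum)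
  have "real T * (\<integral>\<omega>. OPT T \<rho> r \<omega> \<partial>\<Omega>) = (\<Sum>t\<in>{1..T}. \<integral>\<omega>. OPT T \<rho> r \<omega> \<partial>\<Omega>)" by simp
  also have "\<dots> \<le> (\<Sum>t\<in>{1..T}. real T * (\<integral>\<omega>. Z \<omega> t \<partial>\<Omega>))"
    by (rule sum_mono) (rule expected_Z)
  also have "\<dots> = real T * (\<integral>\<omega>. (\<Sum>t\<in>{1..T}. Z \<omega> t) \<partial>\<Omega>)"
    unfolding sum_distrib_left[symmetric]
    using Z_integrable by (subst Bochner_Integration.integral_sum) auto
  finally have "(\<integral>\<omega>. OPT T \<rho> r \<omega> \<partial>\<Omega>) \<le> (\<integral>\<omega>. (\<Sum>t\<in>{1..T}. Z \<omega> t) \<partial>\<Omega>)"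
    using T by simp
  then have "(\<integral>\<omega>. OPT T \<rho> r \<omega> - ?R \<omega> \<partial>\<Omega>) \<le> (\<integral>\<omega>. (\<Sum>t\<in>{1..T}. Z \<omega> t) - ?R \<omega> \<partial>\<Omega>)"
    using OPT_integrable Z_int total_reward_integrable by simp
  also have "\<dots> \<le> bbar * K + drift * \<eta> * real T + c / \<eta>"
    using Z_int total_reward_integrable pathwise_bound[OF _ c]
    by (intro \<Omega>.integral_le_const) auto
  finally show ?thesis .
qed

end

subsection \<open>The regret bound\<close>

theorem theorem1:
  fixes M :: "('d::finite, 'm::finite) request measure"
    and T :: nat
    and \<rho> :: "real ^ 'm"
    and r h :: "real ^ 'm \<Rightarrow> real"
    and fbar bbar abar rbar L \<sigma> \<eta> :: real
    and \<mu>0 :: "real ^ 'm"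
    and A :: "('d, 'm, real ^ 'd) online_rule"
    and a :: "('d, 'm, real ^ 'm) online_rule"
  defines "D \<equiv> dual_dom \<rho> r"
    and "\<rho>min \<equiv> Min (range (\<lambda>j. \<rho> $ j))"
  defines "K \<equiv> (fbar + rbar + L * (bbar + abar)) / \<rho>min"
    and "C1 \<equiv> bbar * (fbar + rbar + L * (bbar + abar)) / \<rho>min"
    and "C2 \<equiv> (bbar + abar)\<^sup>2 / (2 * \<sigma>)"
  defines "C3 \<equiv> (SUP \<mu>\<in>{\<mu>\<in>D. l1norm \<mu> \<le> L + K}. ereal (bregman D h \<mu> \<mu>0))"
  assumes T: "T \<ge> 1"
    and rho_pos: "\<And>j. \<rho> $ j > 0"
    and requests: "fbar \<ge> 0" "bbar \<ge> 0" "\<And>\<gamma>. \<gamma> \<in> space M \<Longrightarrow> valid_request fbar bbar \<gamma>"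
    and r_lipschitz:
      "\<And>a1 a2. a1 \<le> \<rho> \<Longrightarrow> a2 \<le> \<rho> \<Longrightarrow> \<bar>r a1 - r a2\<bar> \<le> L * infnorm (a1 - a2)"
    and r_argmax: "\<And>\<mu>. \<mu> \<in> D \<Longrightarrow> \<exists>v\<in>reg_argmax \<rho> r \<mu>. infnorm v \<le> abar"
    and r_bounded: "\<And>v. 0 \<le> v \<Longrightarrow> v \<le> \<rho> \<Longrightarrow> 0 \<le> r v \<and> r v \<le> rbar"
    and r_concave: "concave_on {..\<rho>} r"
    and h_smooth: "h differentiable_on D \<or> essentially_smooth_in D h"
    and h_convex: "\<sigma> > 0" "strongly_convex_in \<sigma> D h"
    and eta_pos: "\<eta> > 0"
    and init: "\<mu>0 \<in> D" "h differentiable (at \<mu>0 within D)"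
    and alg: "dual_mirror_descent (space M) T \<rho> r abar h \<eta> \<mu>0 A a"
    and alg_measurable: "measurable_run M T A a"
    and OPT_measurable: "OPT T \<rho> r \<in> borel_measurable (\<Pi>\<^sub>M t\<in>{1..T}. M)"
  shows "regret M T \<rho> r A \<le> ereal C1 + ereal (C2 * \<eta> * real T) + C3 / ereal \<eta>"
proof -
  interpret alloc: allocation T \<rho> r h fbar bbar abar rbar L \<sigma> \<eta> \<mu>0
    using T rho_pos requests(1,2) r_lipschitz r_argmax r_bounded r_concave h_smooth h_convex eta_pos init
    unfolding D_def by unfold_locales
  have K: "alloc.K = K"
    unfolding K_def \<rho>min_def alloc.K_def ..
  have C1: "C1 = bbar * alloc.K"
    unfolding C1_def \<rho>min_def alloc.K_def by simp
  have C2: "C2 = alloc.drift"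
    unfolding C2_def alloc.drift_def ..
  have C3_upper: "ereal (bregman D h \<nu> \<mu>0) \<le> C3" if "\<nu> \<in> D" "l1norm \<nu> \<le> L + K" for \<nu>
    unfolding C3_def using that by (intro SUP_upper) simp
  show ?thesis
    unfolding regret_def
  proof (rule SUP_least)
    fix P assume "P \<in> {P. prob_space P \<and> sets P = sets M}"
    then have P: "prob_space P" and sets: "sets P = sets M" by auto
    have space: "space P = space M" by (rule sets_eq_imp_space_eq[OF sets])
    \<comment> \<open>Measurability depends on the \<sigma>-algebra alone, so the hypotheses stated
      for \<open>M\<close> carry over to every \<open>P\<close>.\<close>
    have PiM: "measurable (\<Pi>\<^sub>M t\<in>I. P) N = measurable (\<Pi>\<^sub>M t\<in>I. M) N" for I :: "nat set" and N :: "'z measure"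
      by (intro measurable_cong_sets sets_PiM_cong) (simp_all add: sets)
    interpret P: prob_space P by (rule P)
    interpret run: allocation_run T \<rho> r h fbar bbar abar rbar L \<sigma> \<eta> \<mu>0 P A a
    proof
      show "valid_request fbar bbar \<gamma>" if "\<gamma> \<in> space P" for \<gamma>
        using requests(3) that by (simp add: space)
      show "dual_mirror_descent (space P) T \<rho> r abar h \<eta> \<mu>0 A a"
        using alg by (simp add: space)
      show "measurable_run P T A a"
        using alg_measurable by (simp add: measurable_run_def PiM)
      show "OPT T \<rho> r \<in> borel_measurable (\<Pi>\<^sub>M t\<in>{1..T}. P)"
        using OPT_measurable by (simp only: PiM)
    qed
    show "ereal (\<integral>\<gamma>. OPT T \<rho> r \<gamma> - total_reward T r \<gamma> (play A \<gamma>) \<partial>(\<Pi>\<^sub>M t\<in>{1..T}. P))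
      \<le> ereal C1 + ereal (C2 * \<eta> * real T) + C3 / ereal \<eta>"
    proof (cases C3)
      case (real c)
      have "(\<integral>\<gamma>. OPT T \<rho> r \<gamma> - total_reward T r \<gamma> (play A \<gamma>) \<partial>(\<Pi>\<^sub>M t\<in>{1..T}. P))
          \<le> C1 + C2 * \<eta> * real T + c / \<eta>"
        unfolding C1 C2 run.\<Omega>_def[symmetric]
        using C3_upper by (intro run.expected_regret) (simp add: real K D_def)
      then show ?thesis using eta_pos by (simp add: real)
    next
      case PInf
      then show ?thesis using eta_pos by simp
    next
      case MInf
      \<comment> \<open>The supremum \<open>C3\<close> ranges over a nonempty set: the supergradient
        at \<open>\<rho>\<close> belongs to it.\<close>
      obtain p where "l1norm p \<le> L" "p \<in> D"
        using alloc.supergradient[OF alloc.rho_nonneg] unfolding D_def by blast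
      then have "ereal (bregman D h p \<mu>0) \<le> C3"
        using alloc.K_nonneg by (intro C3_upper) (simp_all add: K)
      then show ?thesis using MInf by simp
    qed
  qed
qed

end
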